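(* Let $\Omega\subset\mathbb{C}^n$ be a domain and let $p$ be a $\mathcal{C}^2$-smooth boundary point of $\Omega$ such that $\partial\Omega$ is Levi-flat near $p$. Assume in addition that $\Omega$ does not intersect the real tangent hyperplane to $\partial\Omega$ at any boundary point near $p$ (for example, this holds if $\Omega$ is convex). Let $\alpha_\Omega$ denote the Carathéodory metric $\gamma_\Omega$ or the Kobayashi metric $\kappa_\Omega$. Then there exist a neighborhood $U_p$ of $p$ and a constant $c_p>0$ such that $$0\le\alpha_\Omega(z;X)-\frac{\|X_N\|}{2\delta_\Omega(z)}\le c_p\|X\|$$ for any $z\in\Omega\cap U_p$ and any $X\in\mathbb{C}^n$.
   Context: $\mathbb{D}$ is the unit disc in $\mathbb{C}$, and $\mathcal{O}(A,B)$ is the set of holomorphic maps $A\to B$. The metrics are $$\gamma_\Omega(z;X)=\sup\{|f'(z)X|:f\in\mathcal{O}(\Omega,\mathbb{D})\},$$ $$\kappa_\Omega(z;X)=\inf\{|t|:\exists\varphi\in\mathcal{O}(\mathbb{D},\Omega):\varphi(0)=z,\ t\varphi'(0)=X\}.$$ $p$ is a $\mathcal{C}^2$-smooth boundary point if near $p$ the boundary is a $\mathcal{C}^2$ real hypersurface with $\Omega=\{\rho<0\}$ locally for a $\mathcal{C}^2$ defining function $\rho$ ($d\rho\neq0$). $\partial\Omega$ is Levi-flat near $p$ if the Levi form (complex Hessian of $\rho$ restricted to the complex tangent space $T^{\mathbb{C}}_q\partial\Omega$) has rank zero at all points $q\in\partial\Omega$ in some neighborhood of $p$. $\delta_\Omega(z)$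 is the Euclidean distance from $z$ to $\partial\Omega$. For each $z\in\Omega$ near $p$ there is a unique point $p(z)\in\partial\Omega$ with $z=p(z)+\delta_\Omega(z)n_{p(z)}$, where $n_{p(z)}$ is the inner unit normal vector at $p(z)$. For such $z$ and $X\in\mathbb{C}^n$, $X=X_N+X_T$ denotes the unique orthogonal decomposition with $X_T\in T^{\mathbb{C}}_{p(z)}\partial\Omega$. $U_p$ is understood to be small enough that $p(z)$ is defined for $z\in\Omega\cap U_p$. *)

theory Defs
  imports "HOL-Analysis.Analysis" "HOL-Complex_Analysis.Complex_Analysis"
begin

text \<open>
  The inner product \<open>\<bullet>\<close> on \<^typ>\<open>complex^'n\<close> is the real one, i.e. the real part of the
  Hermitian product; multiplication by complex scalars is \<open>*s\<close>.
\<close>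

definition holomorphic_to_disc :: "(complex^'n) set \<Rightarrow> (complex^'n \<Rightarrow> complex) set" where
  "holomorphic_to_disc \<Omega> = {f. f ` \<Omega> \<subseteq> ball 0 1 \<and>
     (\<forall>z\<in>\<Omega>. \<exists>f'. (f has_derivative f') (at z) \<and> (\<forall>c v. f' (c *s v) = c * f' v))}"

definition holomorphic_from_disc :: "(complex^'n) set \<Rightarrow> (complex \<Rightarrow> complex^'n) set" where
  "holomorphic_from_disc \<Omega> = {\<phi>. \<phi> ` ball 0 1 \<subseteq> \<Omega> \<and>
     (\<forall>i. (\<lambda>\<zeta>. \<phi> \<zeta> $ i) holomorphic_on ball 0 1)}"

text \<open>
  For open \<open>\<Omega>\<close> and \<open>z \<in> \<Omega>\<close> the sets below are nonempty; the first is bounded above (Cauchy estimates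
  on a ball around \<open>z\<close> in \<open>\<Omega>\<close>) and the second is bounded below by \<open>0\<close>, so the real-valued supremum
  and infimum are the true ones.
\<close>

definition caratheodory_metric :: "(complex^'n) set \<Rightarrow> complex^'n \<Rightarrow> complex^'n \<Rightarrow> real" where
  "caratheodory_metric \<Omega> z X =
     Sup {norm (frechet_derivative f (at z) X) | f. f \<in> holomorphic_to_disc \<Omega>}"

definition kobayashi_metric :: "(complex^'n) set \<Rightarrow> complex^'n \<Rightarrow> complex^'n \<Rightarrow> real" where
  "kobayashi_metric \<Omega> z X =
     Inf {norm t | t :: complex. \<exists>\<phi>\<in>holomorphic_from_disc \<Omega>.
            \<phi> 0 = z \<and> t *s (\<chi> i. deriv (\<lambda>\<zeta>. \<phi> \<zeta> $ i) 0) = X}"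

definition C2_on :: "'a::real_normed_vector set \<Rightarrow> ('a \<Rightarrow> 'b::real_normed_vector) \<Rightarrow> bool" where
  "C2_on U f \<longleftrightarrow> (\<exists>(f' :: 'a \<Rightarrow> 'a \<Rightarrow>\<^sub>L 'b) (f'' :: 'a \<Rightarrow> 'a \<Rightarrow>\<^sub>L ('a \<Rightarrow>\<^sub>L 'b)).
     (\<forall>x\<in>U. (f has_derivative blinfun_apply (f' x)) (at x)) \<and>
     (\<forall>x\<in>U. (f' has_derivative blinfun_apply (f'' x)) (at x)) \<and>
     continuous_on U f'')"

definition C2_defining_function ::
  "(complex^'n) set \<Rightarrow> complex^'n \<Rightarrow> (complex^'n) set \<Rightarrow> (complex^'n \<Rightarrow> real) \<Rightarrow> bool" where
  "C2_defining_function \<Omega> p U \<rho> \<longleftrightarrow>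
     p \<in> frontier \<Omega> \<and> open U \<and> p \<in> U \<and> C2_on U \<rho> \<and>
     (\<forall>x\<in>U. frechet_derivative \<rho> (at x) \<noteq> (\<lambda>v. 0)) \<and>
     \<Omega> \<inter> U = {x\<in>U. \<rho> x < 0} \<and> frontier \<Omega> \<inter> U = {x\<in>U. \<rho> x = 0}"

definition real_tangent_space :: "(complex^'n \<Rightarrow> real) \<Rightarrow> complex^'n \<Rightarrow> (complex^'n) set" where
  "real_tangent_space \<rho> q = {v. frechet_derivative \<rho> (at q) v = 0}"

definition real_tangent_hyperplane :: "(complex^'n \<Rightarrow> real) \<Rightarrow> complex^'n \<Rightarrow> (complex^'n) set" where
  "real_tangent_hyperplane \<rho> q = (\<lambda>v. q + v) ` real_tangent_space \<rho> q"

definition complex_tangent_space :: "(complex^'n \<Rightarrow> real) \<Rightarrow> complex^'n \<Rightarrow> (complex^'n) set" where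
  "complex_tangent_space \<rho> q =
     {v. v \<in> real_tangent_space \<rho> q \<and> \<i> *s v \<in> real_tangent_space \<rho> q}"

definition wirtinger_z :: "'n \<Rightarrow> (complex^'n \<Rightarrow> complex) \<Rightarrow> complex^'n \<Rightarrow> complex" where
  "wirtinger_z j f q =
     (frechet_derivative f (at q) (axis j 1) - \<i> * frechet_derivative f (at q) (axis j \<i>)) / 2"

definition wirtinger_zbar :: "'n \<Rightarrow> (complex^'n \<Rightarrow> complex) \<Rightarrow> complex^'n \<Rightarrow> complex" where
  "wirtinger_zbar j f q =
     (frechet_derivative f (at q) (axis j 1) + \<i> * frechet_derivative f (at q) (axis j \<i>)) / 2"

definition complex_hessian ::
  "(complex^'n \<Rightarrow> real) \<Rightarrow> complex^'n \<Rightarrow> complex^'n \<Rightarrow> complex^'n \<Rightarrow> complex" where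
  "complex_hessian \<rho> q X Y =
     (\<Sum>j\<in>UNIV. \<Sum>k\<in>UNIV.
        wirtinger_z j (wirtinger_zbar k (\<lambda>x. complex_of_real (\<rho> x))) q * X $ j * cnj (Y $ k))"

text \<open>
  A sesquilinear form has rank zero iff it vanishes identically. The condition is independent of the
  choice of defining function: on the complex tangent space, changing \<open>\<rho>\<close> multiplies the Levi form
  by a positive factor.
\<close>

definition levi_flat_near ::
  "(complex^'n) set \<Rightarrow> complex^'n \<Rightarrow> (complex^'n \<Rightarrow> real) \<Rightarrow> bool" where
  "levi_flat_near \<Omega> p \<rho> \<longleftrightarrow> (\<forall>\<^sub>F q in nhds p. q \<in> frontier \<Omega> \<longrightarrow>
     (\<forall>X\<in>complex_tangent_space \<rho> q. \<forall>Y\<in>complex_tangent_space \<rho> q. complex_hessian \<rho> q X Y = 0))"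

definition gradient :: "('a::real_inner \<Rightarrow> real) \<Rightarrow> 'a \<Rightarrow> 'a" where
  "gradient f x = (THE D. GDERIV f x :> D)"

definition inner_unit_normal :: "(complex^'n \<Rightarrow> real) \<Rightarrow> complex^'n \<Rightarrow> complex^'n" where
  "inner_unit_normal \<rho> q = - sgn (gradient \<rho> q)"

definition boundary_distance :: "(complex^'n) set \<Rightarrow> complex^'n \<Rightarrow> real" where
  "boundary_distance \<Omega> z = infdist z (frontier \<Omega>)"

text \<open>
  Any \<open>q\<close> as below lies within \<open>boundary_distance \<Omega> z\<close> of \<open>z\<close>, so for \<open>z\<close> close to \<open>p\<close> only boundary
  points close to \<open>p\<close> matter, where \<open>\<rho>\<close> is a defining function.
\<close>

definition is_boundary_projection ::
  "(complex^'n) set \<Rightarrow> (complex^'n \<Rightarrow> real) \<Rightarrow> complex^'n \<Rightarrow> complex^'n \<Rightarrow> bool" where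
  "is_boundary_projection \<Omega> \<rho> z q \<longleftrightarrow>
     q \<in> frontier \<Omega> \<and> z = q + boundary_distance \<Omega> z *\<^sub>R inner_unit_normal \<rho> q"

definition boundary_projection ::
  "(complex^'n) set \<Rightarrow> (complex^'n \<Rightarrow> real) \<Rightarrow> complex^'n \<Rightarrow> complex^'n" where
  "boundary_projection \<Omega> \<rho> z = (THE q. is_boundary_projection \<Omega> \<rho> z q)"

text \<open>
  The complex tangent space is closed under multiplication by \<open>\<i>\<close>, so its real orthogonal complement
  is also its Hermitian one.
\<close>

definition normal_component ::
  "(complex^'n) set \<Rightarrow> (complex^'n \<Rightarrow> real) \<Rightarrow> complex^'n \<Rightarrow> complex^'n \<Rightarrow> complex^'n" where
  "normal_component \<Omega> \<rho> z X =
     (THE N. N \<in> orthogonal_comp (complex_tangent_space \<rho> (boundary_projection \<Omega> \<rho> z)) \<and>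
             X - N \<in> complex_tangent_space \<rho> (boundary_projection \<Omega> \<rho> z))"

end

theory Submission
  imports Defs
begin

text \<open>
  Both metrics are squeezed between the metric of a half-space and that of a product of a disc with a
  ball.

  \<^emph>\<open>Lower bound.\<close> As \<open>\<Omega>\<close> is connected and misses the real tangent hyperplane at the boundary point
  \<open>q\<close> nearest to \<open>z\<close>, it lies in a half-space bounded by it (\<open>domain_in_half_space\<close>). The Cayley map
  of that half-space onto the disc sends \<open>z\<close> to \<open>0\<close> and competes in the Caratheodory metric; its
  derivative at \<open>z\<close> has modulus exactly \<open>\<parallel>X\<^sub>N\<parallel> / (2\<delta>)\<close>. By the Cauchy estimate every competitor for
  the Caratheodory metric is at most every competitor for the Kobayashi metric, so this bounds both.

  \<^emph>\<open>Upper bound.\<close> It suffices to find one competing disc for the Kobayashi metric. The supporting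
  hyperplanes make the Hessian \<open>H\<close> of \<open>\<rho>\<close> nonnegative on real tangent vectors of the boundary. The Levi
  form on a complex tangent vector \<open>v\<close> is a multiple of \<open>H(v,v) + H(\<i>v,\<i>v)\<close>; as it vanishes, both terms
  do, and then nonnegativity gives \<open>H(v,w) = 0\<close> for every real tangent \<open>w\<close>. So the unit normal is
  stationary in complex tangent directions, and these directions depend on the normal only. A Gronwall
  argument turns this into the fact that an open piece, of uniform size, of the affine complex tangent
  space at \<open>q\<close> lies in the boundary, with the same normal at all its points
  (\<open>complex_tangent_disc_in_boundary\<close>); no foliation has to be constructed. Since \<open>\<rho>\<close> is \<open>C\<^sup>2\<close>, each of
  these points is touched from inside by a ball of a fixed radius \<open>R\<close>, and the union of these balls
  contains the product of a one-dimensional disc of radius \<open>R\<close> in the normal direction and a ball of fixed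
  radius in the complex tangent space. In that product a disc through \<open>z\<close> is written down explicitly: its
  normal part contributes \<open>\<parallel>X\<^sub>N\<parallel> / (2\<delta> - \<delta>\<^sup>2/R)\<close>, which exceeds \<open>\<parallel>X\<^sub>N\<parallel> / (2\<delta>)\<close> only by \<open>O(\<parallel>X\<parallel>)\<close>,
  and its tangential part is \<open>O(\<parallel>X\<parallel>)\<close>.
\<close>

section \<open>Gradient and Hessian of a twice differentiable function\<close>

lemma has_real_derivative_along_line:
  fixes \<rho> :: "'a::real_inner \<Rightarrow> real"
  assumes "(\<rho> has_derivative (\<lambda>v. g \<bullet> v)) (at (a + t *\<^sub>R b))"
  shows "((\<lambda>t. \<rho> (a + t *\<^sub>R b)) has_real_derivative g \<bullet> b) (at t)"
proof -
  have "((\<lambda>t. a + t *\<^sub>R b) has_derivative (\<lambda>h. h *\<^sub>R b)) (at t)"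
    by (auto intro!: derivative_eq_intros)
  from has_derivative_compose[OF this assms] show ?thesis
    by (simp add: has_field_derivative_def mult.commute[of _ "g \<bullet> b"])
qed

lemma mean_value_gradient:
  fixes \<rho> :: "'a::real_inner \<Rightarrow> real"
  assumes "convex S" and "\<And>x. x \<in> S \<Longrightarrow> (\<rho> has_derivative (\<lambda>v. g x \<bullet> v)) (at x)"
    and "x \<in> S" "y \<in> S"
  shows "\<exists>z\<in>S. dist z x \<le> dist y x \<and> \<rho> y - \<rho> x = g z \<bullet> (y - x)"
proof -
  have seg: "x + t *\<^sub>R (y - x) \<in> S" if "0 \<le> t" "t \<le> 1" for t
    using convexD_alt[OF assms(1,3,4) that] by (simp add: algebra_simps)
  obtain t where t: "0 < t" "t < 1"
    "\<rho> (x + 1 *\<^sub>R (y - x)) - \<rho> (x + 0 *\<^sub>R (y - x)) = (1 - 0) * (g (x + t *\<^sub>R (y - x)) \<bullet> (y - x))"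
    using MVT2[of 0 1 "\<lambda>t. \<rho> (x + t *\<^sub>R (y - x))" "\<lambda>t. g (x + t *\<^sub>R (y - x)) \<bullet> (y - x)"]
      has_real_derivative_along_line[OF assms(2)[OF seg]] by auto
  show ?thesis
  proof (rule bexI[of _ "x + t *\<^sub>R (y - x)"], intro conjI)
    show "dist (x + t *\<^sub>R (y - x)) x \<le> dist y x"
      using t by (simp add: dist_norm mult_left_le_one_le)
  qed (use t seg in auto)
qed

text \<open>
  Second differences recover the Hessian: the mean value theorem in the \<open>w\<close> direction writes the second
  difference as \<open>t\<close> times a difference of gradients at two points that differ by \<open>t v\<close>, and
  differentiability of the gradient at the single point \<open>x\<close> evaluates this up to \<open>o(t)\<close>.
\<close>

lemma mixed_difference_quotient:
  fixes \<rho> :: "'a::real_inner \<Rightarrow> real"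
  assumes "\<forall>\<^sub>F y in nhds x. (\<rho> has_derivative (\<lambda>v. g y \<bullet> v)) (at y)"
    and "(g has_derivative H) (at x)" and "0 < e"
  shows "\<forall>\<^sub>F t in at_right 0.
    \<bar>\<rho> (x + t *\<^sub>R v + t *\<^sub>R w) - \<rho> (x + t *\<^sub>R v) - \<rho> (x + t *\<^sub>R w) + \<rho> x - t\<^sup>2 * (H v \<bullet> w)\<bar> \<le> e * t\<^sup>2"
proof -
  interpret H: bounded_linear H using assms(2) by (rule has_derivative_bounded_linear)
  define C where "C = (norm v + 2 * norm w) * norm w"
  define e' where "e' = e / (C + 1)"
  have C: "C \<ge> 0" by (simp add: C_def)
  have e': "e' > 0" "e' * C \<le> e" using C assms(3) by (auto simp: e'_def field_simps)
  obtain d1 where d1: "d1 > 0" "\<And>y. dist y x < d1 \<Longrightarrow> (\<rho> has_derivative (\<lambda>v. g y \<bullet> v)) (at y)"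
    using assms(1) unfolding eventually_nhds_metric by blast
  obtain d2 where d2: "d2 > 0" "\<And>y. norm (y - x) < d2 \<Longrightarrow> norm (g y - g x - H (y - x)) \<le> e' * norm (y - x)"
    using assms(2) e' unfolding has_derivative_at_alt by blast
  define d where "d = min d1 d2 / (norm v + norm w + 1)"
  have nn: "norm v + norm w + 1 > 0" by (smt (verit) norm_ge_zero)
  have d: "d > 0" using d1 d2 nn by (auto simp: d_def)
  have "\<bar>\<rho> (x + t *\<^sub>R v + t *\<^sub>R w) - \<rho> (x + t *\<^sub>R v) - \<rho> (x + t *\<^sub>R w) + \<rho> x - t\<^sup>2 * (H v \<bullet> w)\<bar> \<le> e * t\<^sup>2"
    if t: "0 < t" "t < d" for t
  proof -
    have td: "t * (norm v + norm w) < min d1 d2"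
    proof -
      have "t * (norm v + norm w) \<le> t * (norm v + norm w + 1)" using t by simp
      also have "\<dots> < min d1 d2" using t nn by (simp add: d_def pos_less_divide_eq)
      finally show ?thesis .
    qed
    have small: "norm (a *\<^sub>R v + s *\<^sub>R w) \<le> a * norm v + t * norm w"
      if "0 \<le> a" "a \<le> t" "0 \<le> s" "s \<le> t" for a s
    proof -
      have "norm (a *\<^sub>R v + s *\<^sub>R w) \<le> a * norm v + s * norm w"
        using that norm_triangle_ineq[of "a *\<^sub>R v" "s *\<^sub>R w"] by simp
      also have "\<dots> \<le> a * norm v + t * norm w" using that by (simp add: mult_right_mono)
      finally show ?thesis .
    qed
    have small2: "norm (a *\<^sub>R v + s *\<^sub>R w) < min d1 d2"
      if "0 \<le> a" "a \<le> t" "0 \<le> s" "s \<le> t" for a s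
    proof -
      have "a * norm v + t * norm w \<le> t * (norm v + norm w)"
        using that by (simp add: distrib_left mult_right_mono)
      then show ?thesis using small[OF that] td by linarith
    qed
    have der: "((\<lambda>s. \<rho> (x + t *\<^sub>R v + s *\<^sub>R w) - \<rho> (x + s *\<^sub>R w)) has_real_derivative
        (g (x + t *\<^sub>R v + s *\<^sub>R w) - g (x + s *\<^sub>R w)) \<bullet> w) (at s)" if "0 \<le> s" "s \<le> t" for s
    proof -
      have "dist (x + t *\<^sub>R v + s *\<^sub>R w) x < d1" "dist (x + s *\<^sub>R w) x < d1"
        using small2[of t s] small2[of 0 s] that t by (auto simp: dist_norm add.assoc)
      then show ?thesis
        unfolding inner_diff_left
        by (intro DERIV_diff has_real_derivative_along_line d1(2))
    qed
    obtain s where s: "0 < s" "s < t"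
      "\<rho> (x + t *\<^sub>R v + t *\<^sub>R w) - \<rho> (x + t *\<^sub>R w) - (\<rho> (x + t *\<^sub>R v + 0 *\<^sub>R w) - \<rho> (x + 0 *\<^sub>R w))
        = (t - 0) * ((g (x + t *\<^sub>R v + s *\<^sub>R w) - g (x + s *\<^sub>R w)) \<bullet> w)"
      using MVT2[OF t(1), of "\<lambda>s. \<rho> (x + t *\<^sub>R v + s *\<^sub>R w) - \<rho> (x + s *\<^sub>R w)", OF der]
      by (auto simp: algebra_simps)
    define r1 where "r1 = g (x + t *\<^sub>R v + s *\<^sub>R w) - g x - H (t *\<^sub>R v + s *\<^sub>R w)"
    define r2 where "r2 = g (x + s *\<^sub>R w) - g x - H (s *\<^sub>R w)"
    have "norm r1 \<le> e' * norm (t *\<^sub>R v + s *\<^sub>R w)"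
      using d2(2)[of "x + t *\<^sub>R v + s *\<^sub>R w"] small2[of t s] s t by (simp add: r1_def add.assoc)
    also have "\<dots> \<le> e' * (t * norm v + t * norm w)"
      using small[of t s] s t e' by (intro mult_left_mono) auto
    finally have r1: "norm r1 \<le> e' * (t * norm v + t * norm w)" .
    have "norm r2 \<le> e' * norm (0 *\<^sub>R v + s *\<^sub>R w)"
      using d2(2)[of "x + s *\<^sub>R w"] small2[of 0 s] s t by (simp add: r2_def)
    also have "\<dots> \<le> e' * (t * norm w)"
      using small[of 0 s] s t e' by (intro mult_left_mono) auto
    finally have r2: "norm r2 \<le> e' * (t * norm w)" .
    have "g (x + t *\<^sub>R v + s *\<^sub>R w) - g (x + s *\<^sub>R w) = t *\<^sub>R H v + (r1 - r2)"
      by (simp add: r1_def r2_def H.add H.scaleR)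
    then have eq: "\<rho> (x + t *\<^sub>R v + t *\<^sub>R w) - \<rho> (x + t *\<^sub>R v) - \<rho> (x + t *\<^sub>R w) + \<rho> x - t\<^sup>2 * (H v \<bullet> w)
        = t * ((r1 - r2) \<bullet> w)"
      using s(3) by (simp add: inner_add_left power2_eq_square distrib_left)
    have "\<bar>(r1 - r2) \<bullet> w\<bar> \<le> norm (r1 - r2) * norm w" by (rule Cauchy_Schwarz_ineq2)
    also have "\<dots> \<le> (e' * (t * norm v + t * norm w) + e' * (t * norm w)) * norm w"
      using r1 r2 norm_triangle_ineq4[of r1 r2] by (intro mult_right_mono) auto
    also have "\<dots> = t * (e' * C)" by (simp add: C_def algebra_simps)
    also have "\<dots> \<le> t * e" using e' t by (intro mult_left_mono) auto
    finally have "t * \<bar>(r1 - r2) \<bullet> w\<bar> \<le> t * (t * e)" using t by (intro mult_left_mono) auto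
    then show ?thesis unfolding eq using t by (simp add: abs_mult power2_eq_square mult_ac)
  qed
  then show ?thesis using d unfolding eventually_at_right_field by auto
qed

text \<open>
  The second difference of the preceding lemma is symmetric in \<open>v\<close> and \<open>w\<close>, hence so is its limit.
\<close>

lemma hessian_symmetric:
  fixes \<rho> :: "'a::real_inner \<Rightarrow> real"
  assumes "\<forall>\<^sub>F y in nhds x. (\<rho> has_derivative (\<lambda>v. g y \<bullet> v)) (at y)"
    and "(g has_derivative H) (at x)"
  shows "H v \<bullet> w = H w \<bullet> v"
proof -
  have "\<bar>H v \<bullet> w - H w \<bullet> v\<bar> \<le> e" if "e > 0" for e
  proof -
    from that have "e / 2 > 0" by simp
    note ev = mixed_difference_quotient[OF assms this]
    have "\<forall>\<^sub>F t in at_right (0::real). t > 0" by (simp add: eventually_at_right_less)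
    with ev[of v w] ev[of w v] have "\<forall>\<^sub>F t in at_right (0::real). t\<^sup>2 * \<bar>H v \<bullet> w - H w \<bullet> v\<bar> \<le> t\<^sup>2 * e \<and> t > 0"
    proof eventually_elim
      case (elim t)
      have "x + t *\<^sub>R w + t *\<^sub>R v = x + t *\<^sub>R v + t *\<^sub>R w" by simp
      with elim(2) have "\<bar>\<rho> (x + t *\<^sub>R v + t *\<^sub>R w) - \<rho> (x + t *\<^sub>R v) - \<rho> (x + t *\<^sub>R w) + \<rho> x
          - t\<^sup>2 * (H w \<bullet> v)\<bar> \<le> e / 2 * t\<^sup>2"
        by (simp add: algebra_simps)
      with elim(1) have "\<bar>t\<^sup>2 * (H v \<bullet> w) - t\<^sup>2 * (H w \<bullet> v)\<bar> \<le> e / 2 * t\<^sup>2 + e / 2 * t\<^sup>2" by linarith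
      then have "\<bar>t\<^sup>2 * (H v \<bullet> w) - t\<^sup>2 * (H w \<bullet> v)\<bar> \<le> e * t\<^sup>2" by simp
      moreover have "t\<^sup>2 * (H v \<bullet> w) - t\<^sup>2 * (H w \<bullet> v) = t\<^sup>2 * (H v \<bullet> w - H w \<bullet> v)"
        by (simp add: algebra_simps)
      ultimately show ?case using elim by (simp add: abs_mult mult.commute)
    qed
    from eventually_happens'[OF _ this] obtain t :: real
      where "t > 0" "t\<^sup>2 * \<bar>H v \<bullet> w - H w \<bullet> v\<bar> \<le> t\<^sup>2 * e" by auto
    then show ?thesis by simp
  qed
  from field_le_epsilon[of "\<bar>H v \<bullet> w - H w \<bullet> v\<bar>" 0] this show ?thesis by auto
qed

text \<open>
  Passes from derivatives that are linear forms to vectors, by the Riesz representation. The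
  bound on the Hessian near \<open>p\<close> comes from the continuity of the second derivative at \<open>p\<close>.
\<close>

lemma C2_on_gradient_hessian:
  fixes \<rho> :: "'a::euclidean_space \<Rightarrow> real"
  assumes "open U" "C2_on U \<rho>" "p \<in> U"
  obtains r M :: real and g :: "'a \<Rightarrow> 'a" and H :: "'a \<Rightarrow> 'a \<Rightarrow> 'a" where
    "0 < r" "0 < M" "ball p r \<subseteq> U"
    "\<And>x. x \<in> ball p r \<Longrightarrow> (\<rho> has_derivative (\<lambda>v. g x \<bullet> v)) (at x)"
    "\<And>x. x \<in> ball p r \<Longrightarrow> (g has_derivative H x) (at x)"
    "\<And>x v. x \<in> ball p r \<Longrightarrow> norm (H x v) \<le> M * norm v"
    "\<And>x v w. x \<in> ball p r \<Longrightarrow> H x v \<bullet> w = H x w \<bullet> v"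
proof -
  obtain \<rho>' :: "'a \<Rightarrow> 'a \<Rightarrow>\<^sub>L real" and \<rho>'' :: "'a \<Rightarrow> 'a \<Rightarrow>\<^sub>L ('a \<Rightarrow>\<^sub>L real)" where
    d: "\<And>x. x \<in> U \<Longrightarrow> (\<rho> has_derivative blinfun_apply (\<rho>' x)) (at x)"
    "\<And>x. x \<in> U \<Longrightarrow> (\<rho>' has_derivative blinfun_apply (\<rho>'' x)) (at x)" and c: "continuous_on U \<rho>''"
    using assms(2) unfolding C2_on_def by blast
  have riesz: "(\<Sum>b\<in>Basis. blinfun_apply L b *\<^sub>R b) \<bullet> v = L v" for L :: "'a \<Rightarrow>\<^sub>L real" and v
  proof -
    have "L v = L (\<Sum>b\<in>Basis. (v \<bullet> b) *\<^sub>R b)" by (simp add: euclidean_representation)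
    also have "\<dots> = (\<Sum>b\<in>Basis. (v \<bullet> b) * L b)" by (simp add: blinfun.bilinear_simps)
    finally show ?thesis by (simp add: inner_sum_left mult.commute[of "blinfun_apply L _"] inner_commute[of v])
  qed
  define g where "g = (\<lambda>x. \<Sum>b\<in>Basis. \<rho>' x b *\<^sub>R b)"
  define H where "H = (\<lambda>x v. \<Sum>b\<in>Basis. \<rho>'' x v b *\<^sub>R b)"
  have g: "(\<rho> has_derivative (\<lambda>v. g x \<bullet> v)) (at x)" if "x \<in> U" for x
    using d(1)[OF that] by (simp add: g_def riesz)
  have H: "(g has_derivative H x) (at x)" if "x \<in> U" for x
    unfolding g_def H_def
    by (auto intro!: derivative_eq_intros d(2)[OF that] simp: blinfun.bilinear_simps)
  have "isCont \<rho>'' p" using c assms(1,3) by (simp add: continuous_on_eq_continuous_at)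
  then obtain r1 where r1: "r1 > 0" "\<And>x. dist x p < r1 \<Longrightarrow> dist (\<rho>'' x) (\<rho>'' p) < 1"
    unfolding continuous_at_eps_delta by (metis zero_less_one)
  obtain r2 where r2: "r2 > 0" "ball p r2 \<subseteq> U" using assms(1,3) openE by blast
  define M where "M = norm (\<rho>'' p) + 1"
  have M: "norm (\<rho>'' x) \<le> M" if "dist x p < r1" for x
    using r1(2)[OF that] norm_triangle_sub[of "\<rho>'' x" "\<rho>'' p"] by (simp add: M_def dist_norm)
  show thesis
  proof (rule that[of "min r1 r2" M g H])
    show "0 < min r1 r2" "ball p (min r1 r2) \<subseteq> U" using r1 r2 by auto
    show "0 < M" by (simp add: M_def add_nonneg_pos)
    fix x assume x: "x \<in> ball p (min r1 r2)"
    then have xU: "x \<in> U" using r2 by auto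
    show "(\<rho> has_derivative (\<lambda>v. g x \<bullet> v)) (at x)" "(g has_derivative H x) (at x)" using g H xU by auto
    fix v w
    have "\<forall>\<^sub>F y in nhds x. (\<rho> has_derivative (\<lambda>v. g y \<bullet> v)) (at y)"
      using eventually_nhds_in_open[OF assms(1) xU] by eventually_elim (rule g)
    from hessian_symmetric[OF this H[OF xU]] show "H x v \<bullet> w = H x w \<bullet> v" .
    have "norm (H x v) * norm (H x v) = H x v \<bullet> H x v"
      by (simp add: dot_square_norm power2_eq_square)
    also have "\<dots> = \<rho>'' x v (H x v)" unfolding H_def by (rule riesz)
    also have "\<dots> \<le> norm (\<rho>'' x v) * norm (H x v)"
      using norm_blinfun[of "\<rho>'' x v" "H x v"] by (simp add: abs_le_iff)
    also have "\<dots> \<le> (norm (\<rho>'' x) * norm v) * norm (H x v)"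
      by (intro mult_right_mono norm_blinfun) auto
    also have "\<dots> \<le> (M * norm v) * norm (H x v)"
      using M[of x] x by (intro mult_right_mono) (auto simp: dist_commute)
    finally show "norm (H x v) \<le> M * norm v"
      by (cases "norm (H x v) = 0") (use \<open>0 < M\<close> in auto)
  qed
qed

text \<open>
  Gronwall's inequality with zero initial value: \<open>\<parallel>m\<parallel>\<^sup>2 e\<^bsup>-2Ct\<^esup>\<close> does not increase.
\<close>

lemma gronwall_zero:
  fixes m :: "real \<Rightarrow> 'a::real_inner"
  assumes "\<And>t. t \<in> {0..1} \<Longrightarrow> (m has_vector_derivative m' t) (at t)"
    and "\<And>t. t \<in> {0..1} \<Longrightarrow> norm (m' t) \<le> C * norm (m t)" and "m 0 = 0" and "t \<in> {0..1}"
  shows "m t = 0"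
proof -
  let ?u = "\<lambda>t. (m t \<bullet> m t) * exp (- (2 * C) * t)"
  have "?u t \<le> ?u 0"
  proof (rule DERIV_nonpos_imp_nonincreasing[where f = ?u])
    fix s assume "0 \<le> s" "s \<le> t"
    then have s: "s \<in> {0..1}" using assms(4) by auto
    have "((\<lambda>s. m s \<bullet> m s) has_real_derivative 2 * (m s \<bullet> m' s)) (at s)"
      unfolding has_field_derivative_def
      by (rule derivative_eq_intros assms(1)[OF s, unfolded has_vector_derivative_def] refl)+
        (auto simp: inner_commute algebra_simps)
    then have der: "(?u has_real_derivative 2 * (m s \<bullet> m' s - C * (m s \<bullet> m s)) * exp (- (2 * C) * s)) (at s)"
      by (auto intro!: derivative_eq_intros simp: algebra_simps)
    have "m s \<bullet> m' s \<le> C * (m s \<bullet> m s)"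
    proof -
      have "m s \<bullet> m' s \<le> norm (m s) * norm (m' s)" by (rule norm_cauchy_schwarz)
      also have "\<dots> \<le> norm (m s) * (C * norm (m s))" using assms(2)[OF s] by (rule mult_left_mono) simp
      finally show ?thesis by (simp add: dot_square_norm power2_eq_square mult_ac)
    qed
    then have "2 * (m s \<bullet> m' s - C * (m s \<bullet> m s)) * exp (- (2 * C) * s) \<le> 0"
      by (simp add: mult_le_0_iff)
    with der show "\<exists>y. (?u has_real_derivative y) (at s) \<and> y \<le> 0" by blast
  qed (use assms(4) in auto)
  then have "m t \<bullet> m t \<le> 0" using assms(3) by (simp add: mult_le_0_iff)
  then show ?thesis using inner_gt_zero_iff[of "m t"] by linarith
qed

lemma norm_sgn_diff_le:
  fixes x y :: "'a::real_normed_vector"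
  assumes "x \<noteq> 0"
  shows "norm (sgn x - sgn y) \<le> 2 * norm (x - y) / norm x"
proof (cases "y = 0")
  case False
  have "sgn x - sgn y = (1 / norm x) *\<^sub>R (x - y) + (1 / norm x - 1 / norm y) *\<^sub>R y"
    by (simp add: sgn_div_norm divide_inverse algebra_simps)
  then have "norm (sgn x - sgn y) \<le> norm (x - y) / norm x + \<bar>1 / norm x - 1 / norm y\<bar> * norm y"
    using norm_triangle_ineq[of "(1 / norm x) *\<^sub>R (x - y)" "(1 / norm x - 1 / norm y) *\<^sub>R y"] by simp
  also have "\<bar>1 / norm x - 1 / norm y\<bar> * norm y = \<bar>norm y - norm x\<bar> / norm x"
  proof -
    have "(1 / norm x - 1 / norm y) * norm y = (norm y - norm x) / norm x"
      using assms False by (simp add: field_simps)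
    then show ?thesis by (metis abs_divide abs_mult abs_norm_cancel)
  qed
  also have "\<bar>norm y - norm x\<bar> / norm x \<le> norm (x - y) / norm x"
    by (intro divide_right_mono) (metis norm_minus_commute norm_triangle_ineq3, simp)
  finally show ?thesis by simp
qed (use assms in \<open>simp add: norm_sgn\<close>)

text \<open>
  Used for a nonnegative quadratic form: a vector on which the form vanishes lies in its kernel.
\<close>

lemma quadratic_nonneg_linear_zero:
  fixes b c :: real
  assumes "\<And>t. 0 \<le> 2 * t * b + t\<^sup>2 * c"
  shows "b = 0"
proof (rule ccontr)
  assume b: "b \<noteq> 0"
  define k where "k = \<bar>c\<bar> + 1"
  have k: "k > 0" "c < k" by (auto simp: k_def)
  have "2 * (- b / k) * b + (- b / k)\<^sup>2 * c = (b\<^sup>2 / k) * (c / k - 2)"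
    using k by (simp add: field_simps power2_eq_square)
  also have "\<dots> < 0" using b k by (intro mult_pos_neg) (auto simp: field_simps)
  finally show False using assms[of "- b / k"] by simp
qed

lemma norm_project_le:
  fixes n w :: "'a::real_inner"
  assumes "norm n = 1"
  shows "norm (w - (w \<bullet> n) *\<^sub>R n) \<le> norm w"
proof -
  have "n \<bullet> n = 1" using assms by (simp add: dot_square_norm)
  then have "(norm (w - (w \<bullet> n) *\<^sub>R n))\<^sup>2 = (norm w)\<^sup>2 - (w \<bullet> n)\<^sup>2"
    unfolding power2_norm_eq_inner
    by (simp add: inner_diff_left inner_diff_right inner_commute[of n w] power2_eq_square)
  then have "(norm (w - (w \<bullet> n) *\<^sub>R n))\<^sup>2 \<le> (norm w)\<^sup>2" by simp
  then show ?thesis by (rule power2_le_imp_le) simp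
qed

section \<open>Complex structure of \<open>\<complex>\<^sup>n\<close>\<close>

text \<open>
  Reduces complex scalars to real ones and to the map \<open>v \<mapsto> \<i>v\<close>, which is an isometry of the real inner
  product; all Hermitian geometry below is phrased in these terms.
\<close>

lemma scale_complex_eq: "a *s v = Re a *\<^sub>R v + Im a *\<^sub>R (\<i> *s v)" for v :: "complex^'n"
  by (simp add: vec_eq_iff complex_eq_iff)

lemma inner_i_i [simp]: "(\<i> *s v) \<bullet> (\<i> *s w) = v \<bullet> w" for v w :: "complex^'n"
  by (simp add: inner_vec_def inner_complex_def add.commute)

lemma inner_i_left: "(\<i> *s v) \<bullet> w = - (v \<bullet> (\<i> *s w))" for v w :: "complex^'n"
  by (simp add: inner_vec_def inner_complex_def flip: sum_negf)

lemma inner_i_swap: "v \<bullet> (\<i> *s w) = - (w \<bullet> (\<i> *s v))" for v w :: "complex^'n"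
  using inner_i_left[of w v] by (simp add: inner_commute)

lemma inner_i_self [simp]: "v \<bullet> (\<i> *s v) = 0" for v :: "complex^'n"
  using inner_i_left[of v v] by (simp add: inner_commute)

lemma norm_i_scale [simp]: "norm (\<i> *s v) = norm v" for v :: "complex^'n"
  by (simp add: norm_eq_sqrt_inner)

lemma i_scale_scaleR [simp]: "\<i> *s (r *\<^sub>R v) = r *\<^sub>R (\<i> *s v)" for v :: "complex^'n"
  by (simp add: vec_eq_iff)

lemma norm_complex_scale: "norm (a *s v) = cmod a * norm v" for v :: "complex^'n"
proof -
  have "(norm (a *s v))\<^sup>2 = (cmod a * norm v)\<^sup>2"
    unfolding power2_norm_eq_inner power_mult_distrib cmod_power2
    by (subst (1 2) scale_complex_eq) (simp add: inner_add_left inner_add_right inner_commute inner_complex_def algebra_simps power2_eq_square)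
  then show ?thesis by (simp add: power2_eq_iff_nonneg)
qed

lemma scale_of_real: "complex_of_real r *s v = r *\<^sub>R v" for v :: "complex^'n"
  by (subst scale_complex_eq) simp

text \<open>
  The Hermitian product of \<open>w\<close> with \<open>n\<close>, linear in \<open>w\<close>.
\<close>

definition complex_coordinate :: "complex^'n \<Rightarrow> complex^'n \<Rightarrow> complex" where
  "complex_coordinate n w = Complex (w \<bullet> n) (w \<bullet> (\<i> *s n))"

lemma complex_coordinate_add: "complex_coordinate n (v + w) = complex_coordinate n v + complex_coordinate n w"
  and complex_coordinate_diff: "complex_coordinate n (v - w) = complex_coordinate n v - complex_coordinate n w"
  by (simp_all add: complex_coordinate_def inner_add_left inner_diff_left complex_eq_iff)

lemma complex_coordinate_scale: "complex_coordinate n (a *s w) = a * complex_coordinate n w"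
  by (subst scale_complex_eq)
    (simp add: complex_coordinate_def complex_eq_iff inner_add_left inner_i_left algebra_simps)

lemma complex_coordinate_self: "norm n = 1 \<Longrightarrow> complex_coordinate n n = 1"
  by (simp add: complex_coordinate_def complex_eq_iff dot_square_norm)

lemma bounded_linear_complex_coordinate: "bounded_linear (complex_coordinate n)"
proof -
  have "linear (complex_coordinate n)"
    by (rule linearI) (simp_all add: complex_coordinate_add, simp add: complex_coordinate_def complex_eq_iff)
  then show ?thesis by (simp add: linear_conv_bounded_linear)
qed

definition complex_orthogonal :: "complex^'n \<Rightarrow> (complex^'n) set" where
  "complex_orthogonal n = {v. v \<bullet> n = 0 \<and> v \<bullet> (\<i> *s n) = 0}"

lemma complex_coordinate_eq_0_iff: "complex_coordinate n v = 0 \<longleftrightarrow> v \<in> complex_orthogonal n"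
  by (simp add: complex_coordinate_def complex_orthogonal_def complex_eq_iff)

lemma complex_orthogonal_scale: "v \<in> complex_orthogonal n \<Longrightarrow> a *s v \<in> complex_orthogonal n"
  by (simp add: complex_coordinate_scale flip: complex_coordinate_eq_0_iff)

lemma complex_orthogonal_scaleR: "r \<noteq> 0 \<Longrightarrow> complex_orthogonal (r *\<^sub>R n) = complex_orthogonal n"
  by (simp add: complex_orthogonal_def)

lemma diff_complex_projection_orthogonal:
  "norm n = 1 \<Longrightarrow> X - complex_coordinate n X *s n \<in> complex_orthogonal n"
  by (simp add: complex_coordinate_diff complex_coordinate_scale complex_coordinate_self
      flip: complex_coordinate_eq_0_iff)

text \<open>
  Identifies the normal component of a vector: if \<open>n\<close> is the unit normal, the complex orthogonal
  complement of \<open>n\<close> is the complex tangent space, and the component orthogonal to it is the Hermitian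
  projection to the line of \<open>n\<close>.
\<close>

lemma orthogonal_comp_complex_orthogonal:
  assumes "norm n = 1"
  shows "N \<in> orthogonal_comp (complex_orthogonal n) \<and> X - N \<in> complex_orthogonal n
    \<longleftrightarrow> N = complex_coordinate n X *s n"
proof
  have co: "complex_coordinate n X *s n \<in> orthogonal_comp (complex_orthogonal n)"
    by (subst scale_complex_eq) (auto simp: orthogonal_comp_def orthogonal_def complex_orthogonal_def inner_add_right)
  note diff = diff_complex_projection_orthogonal[OF assms, of X]
  show "N \<in> orthogonal_comp (complex_orthogonal n) \<and> X - N \<in> complex_orthogonal n"
    if "N = complex_coordinate n X *s n" using that co diff by simp
  assume N: "N \<in> orthogonal_comp (complex_orthogonal n) \<and> X - N \<in> complex_orthogonal n"
  let ?D = "N - complex_coordinate n X *s n"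
  have "?D \<in> orthogonal_comp (complex_orthogonal n)"
    using N co subspace_orthogonal_comp subspace_diff by blast
  moreover have "?D = (X - complex_coordinate n X *s n) - (X - N)" by simp
  then have "?D \<in> complex_orthogonal n"
    using diff N by (simp only:) (simp add: complex_coordinate_diff flip: complex_coordinate_eq_0_iff)
  ultimately have "?D \<bullet> ?D = 0" unfolding orthogonal_comp_def orthogonal_def by blast
  then show "N = complex_coordinate n X *s n" by simp
qed

section \<open>The Levi form as a sum of two Hessian values\<close>

text \<open>
  The Wirtinger operators split a real-linear form into its complex-linear and its conjugate-linear part.
  Contracting the coefficients with \<open>X\<close> thus only produces the values of the form at \<open>X\<close> and \<open>\<i>X\<close>.
\<close>

lemma sum_wirtinger:
  fixes L :: "complex^'n \<Rightarrow> real"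
  assumes "linear L"
  shows "(\<Sum>j\<in>UNIV. (of_real (L (axis j 1)) - \<i> * of_real (L (axis j \<i>))) * X $ j)
    = of_real (L X) - \<i> * of_real (L (\<i> *s X))" (is ?hol)
    and "(\<Sum>j\<in>UNIV. (of_real (L (axis j 1)) + \<i> * of_real (L (axis j \<i>))) * cnj (X $ j))
    = of_real (L X) + \<i> * of_real (L (\<i> *s X))" (is ?antihol)
proof -
  interpret linear L by fact
  have expand: "L Y = (\<Sum>j\<in>UNIV. Re (Y $ j) * L (axis j 1) + Im (Y $ j) * L (axis j \<i>))" for Y
  proof -
    have "Y = (\<Sum>j\<in>UNIV. Re (Y $ j) *\<^sub>R axis j 1 + Im (Y $ j) *\<^sub>R axis j \<i>)"
      by (simp add: vec_eq_iff axis_def if_distrib complex_eq_iff cong: if_cong)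
    then have "L Y = L (\<Sum>j\<in>UNIV. Re (Y $ j) *\<^sub>R axis j 1 + Im (Y $ j) *\<^sub>R axis j \<i>)" by simp
    then show ?thesis by (simp add: sum add scale)
  qed
  show ?hol
    unfolding expand[of X] expand[of "\<i> *s X"]
    by (simp add: complex_eq_iff algebra_simps sum.distrib sum_subtractf sum_negf)
  from arg_cong[OF this, of cnj] show ?antihol by simp
qed

lemma Re_complex_hessian:
  fixes \<rho> :: "complex^'n \<Rightarrow> real"
  assumes ev: "\<forall>\<^sub>F y in nhds q. (\<rho> has_derivative (\<lambda>v. g y \<bullet> v)) (at y)"
    and H: "(g has_derivative H) (at q)"
  shows "Re (complex_hessian \<rho> q X X) = (H X \<bullet> X + H (\<i> *s X) \<bullet> (\<i> *s X)) / 4"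
proof -
  interpret H: bounded_linear H using H by (rule has_derivative_bounded_linear)
  define a where "a = (\<lambda>k w. (complex_of_real (H w \<bullet> axis k 1) + \<i> * complex_of_real (H w \<bullet> axis k \<i>)) / 2)"
  have "\<forall>\<^sub>F y in nhds q. wirtinger_zbar k (\<lambda>x. complex_of_real (\<rho> x)) y =
      (of_real (g y \<bullet> axis k 1) + \<i> * of_real (g y \<bullet> axis k \<i>)) / 2" for k
    using ev
  proof eventually_elim
    case (elim y)
    have "((\<lambda>x. complex_of_real (\<rho> x)) has_derivative (\<lambda>v. complex_of_real (g y \<bullet> v))) (at y)"
      by (rule has_derivative_of_real[OF elim])
    from frechet_derivative_at[OF this, symmetric] show ?case by (simp add: wirtinger_zbar_def)
  qed
  then have eq: "\<forall>\<^sub>F y in nhds q. (of_real (g y \<bullet> axis k 1) + \<i> * of_real (g y \<bullet> axis k \<i>)) / 2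
      = wirtinger_zbar k (\<lambda>x. complex_of_real (\<rho> x)) y" for k
    by (simp add: eq_commute)
  have der: "((\<lambda>y. (complex_of_real (g y \<bullet> axis k 1) + \<i> * of_real (g y \<bullet> axis k \<i>)) / 2)
      has_derivative a k) (at q)" for k
    unfolding a_def by (auto intro!: derivative_eq_intros H)
  have "(wirtinger_zbar k (\<lambda>x. complex_of_real (\<rho> x)) has_derivative a k) (at q)" for k
  proof -
    obtain S where S: "open S" "q \<in> S" "\<forall>y\<in>S. (of_real (g y \<bullet> axis k 1) + \<i> * of_real (g y \<bullet> axis k \<i>)) / 2
      = wirtinger_zbar k (\<lambda>x. complex_of_real (\<rho> x)) y"
      using eq[of k] unfolding eventually_nhds by blast
    show ?thesis using has_derivative_transform_within_open[OF der S(1,2)] S(3) by blast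
  qed
  from frechet_derivative_at[OF this, symmetric]
  have W: "wirtinger_z j (wirtinger_zbar k (\<lambda>x. complex_of_real (\<rho> x))) q =
      (a k (axis j 1) - \<i> * a k (axis j \<i>)) / 2" for j k
    by (simp add: wirtinger_z_def)
  \<comment> \<open>The conjugate index of the Levi form is contracted first, with the first slot fixed at \<open>w\<close>.\<close>
  have a_sum: "(\<Sum>k\<in>UNIV. a k w * cnj (X $ k)) = (of_real (H w \<bullet> X) + \<i> * of_real (H w \<bullet> (\<i> *s X))) / 2" for w
  proof -
    have "linear (\<lambda>v. H w \<bullet> v)" by (rule linearI) (simp_all add: inner_add_right)
    from sum_wirtinger(2)[OF this, of X] show ?thesis
      by (simp add: a_def sum_divide_distrib[symmetric])
  qed
  have "complex_hessian \<rho> q X X = (\<Sum>j\<in>UNIV.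
      ((\<Sum>k\<in>UNIV. a k (axis j 1) * cnj (X $ k)) - \<i> * (\<Sum>k\<in>UNIV. a k (axis j \<i>) * cnj (X $ k))) / 2 * X $ j)"
    unfolding complex_hessian_def W
    by (rule sum.cong) (simp_all add: sum_distrib_left sum_distrib_right sum_divide_distrib algebra_simps
        diff_divide_distrib flip: sum_subtractf)
  also have "\<dots> = ((\<Sum>j\<in>UNIV. (of_real (H (axis j 1) \<bullet> X) - \<i> * of_real (H (axis j \<i>) \<bullet> X)) * X $ j)
      + \<i> * (\<Sum>j\<in>UNIV. (of_real (H (axis j 1) \<bullet> (\<i> *s X)) - \<i> * of_real (H (axis j \<i>) \<bullet> (\<i> *s X))) * X $ j)) / 4"
    unfolding a_sum
    by (simp add: sum_distrib_left sum_divide_distrib algebra_simps diff_divide_distrib add_divide_distrib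
        flip: sum_subtractf sum.distrib)
  also have "\<dots> = ((of_real (H X \<bullet> X) - \<i> * of_real (H (\<i> *s X) \<bullet> X))
      + \<i> * (of_real (H X \<bullet> (\<i> *s X)) - \<i> * of_real (H (\<i> *s X) \<bullet> (\<i> *s X)))) / 4"
  proof -
    have "linear (\<lambda>w. H w \<bullet> v)" for v by (rule linearI) (simp_all add: H.add H.scaleR inner_add_left)
    from sum_wirtinger(1)[OF this] show ?thesis by simp
  qed
  finally have eq: "complex_hessian \<rho> q X X = \<dots>" .
  show ?thesis unfolding eq by simp
qed

section \<open>Competitors for the two metrics\<close>

text \<open>
  Holomorphy of a disc is given componentwise; composing it with a function of several variables needs
  the derivative of the vector-valued map.
\<close>

lemma holomorphic_disc_has_derivative:
  fixes \<phi> :: "complex \<Rightarrow> complex^'n"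
  assumes "\<phi> \<in> holomorphic_from_disc \<Omega>" and "\<zeta> \<in> ball 0 1"
  shows "(\<phi> has_derivative (\<lambda>h. h *s (\<chi> i. deriv (\<lambda>\<zeta>. \<phi> \<zeta> $ i) \<zeta>))) (at \<zeta>)"
proof -
  have comp: "((\<lambda>\<zeta>. \<phi> \<zeta> $ i) has_derivative (\<lambda>h. deriv (\<lambda>\<zeta>. \<phi> \<zeta> $ i) \<zeta> * h)) (at \<zeta>)" for i
    using assms holomorphic_derivI[of "\<lambda>\<zeta>. \<phi> \<zeta> $ i" "ball 0 1" \<zeta>]
    by (simp add: holomorphic_from_disc_def has_field_derivative_def)
  show ?thesis
  proof (rule has_derivative_componentwise_within[THEN iffD2], rule ballI)
    fix b :: "complex^'n" assume "b \<in> Basis"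
    then obtain i u where b: "b = axis i u" by (auto simp: Basis_vec_def)
    show "((\<lambda>x. \<phi> x \<bullet> b) has_derivative (\<lambda>x. (x *s (\<chi> i. deriv (\<lambda>\<zeta>. \<phi> \<zeta> $ i) \<zeta>)) \<bullet> b)) (at \<zeta>)"
      unfolding b inner_axis using has_derivative_inner_left[OF comp[of i], of u] by (simp add: mult.commute)
  qed
qed

text \<open>
  The composition \<open>f \<circ> \<phi>\<close> maps the disc to itself, so by the Cauchy estimate its derivative at \<open>0\<close> has
  modulus at most \<open>1\<close>; by the chain rule \<open>t\<close> times that derivative is \<open>f'(z) X\<close>.
\<close>

lemma caratheodory_candidate_le_kobayashi_candidate:
  assumes f: "f \<in> holomorphic_to_disc \<Omega>" and \<phi>: "\<phi> \<in> holomorphic_from_disc \<Omega>"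
    and "\<phi> 0 = z" and X: "t *s (\<chi> i. deriv (\<lambda>\<zeta>. \<phi> \<zeta> $ i) 0) = X"
  shows "norm (frechet_derivative f (at z) X) \<le> norm t"
proof -
  define D where "D = (\<lambda>\<zeta>. \<chi> i. deriv (\<lambda>\<zeta>. \<phi> \<zeta> $ i) \<zeta>)"
  have in_dom: "\<phi> \<zeta> \<in> \<Omega>" if "\<zeta> \<in> ball 0 1" for \<zeta> using \<phi> that by (auto simp: holomorphic_from_disc_def)
  obtain F where F: "\<And>w. w \<in> \<Omega> \<Longrightarrow> (f has_derivative F w) (at w)"
    "\<And>w c v. w \<in> \<Omega> \<Longrightarrow> F w (c *s v) = c * F w v"
    using f unfolding holomorphic_to_disc_def mem_Collect_eq by metis
  have comp: "((\<lambda>\<zeta>. f (\<phi> \<zeta>)) has_field_derivative F (\<phi> \<zeta>) (D \<zeta>)) (at \<zeta>)" if "\<zeta> \<in> ball 0 1" for \<zeta>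
  proof -
    from has_derivative_compose[OF holomorphic_disc_has_derivative[OF \<phi> that] F(1)[OF in_dom[OF that]]]
    show ?thesis
      unfolding F(2)[OF in_dom[OF that]] by (simp add: has_field_derivative_def D_def mult.commute[of _ "F _ _"])
  qed
  then have hol: "(\<lambda>\<zeta>. f (\<phi> \<zeta>)) holomorphic_on ball 0 1"
    by (meson field_differentiable_at_within field_differentiable_def holomorphic_onI)
  have zero: "(0::complex) \<in> ball 0 1" by simp
  have d0: "deriv (\<lambda>\<zeta>. f (\<phi> \<zeta>)) 0 = F z (D 0)"
    using DERIV_imp_deriv[OF comp[OF zero]] assms(3) by simp
  have "norm (F z (D 0)) \<le> 1"
  \<comment> \<open>The Cauchy estimate on the circle of radius \<open>r < 1\<close> gives \<open>1 / r\<close>; then \<open>r\<close> tends to \<open>1\<close>.\<close>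
  proof (rule field_le_mult_one_interval)
    fix r :: real assume r: "0 < r" "r < 1"
    have sub: "cball 0 r \<subseteq> ball (0::complex) 1" using r by auto
    have "cmod ((deriv ^^ 1) (\<lambda>\<zeta>. f (\<phi> \<zeta>)) 0) \<le> fact 1 * 1 / r ^ 1"
    proof (rule Cauchy_higher_deriv_bound)
      show "(\<lambda>\<zeta>. f (\<phi> \<zeta>)) holomorphic_on ball 0 r"
        using hol sub ball_subset_cball by (meson holomorphic_on_subset order_trans)
      show "continuous_on (cball 0 r) (\<lambda>\<zeta>. f (\<phi> \<zeta>))"
        using hol sub by (meson holomorphic_on_imp_continuous_on holomorphic_on_subset)
      show "f (\<phi> w) \<in> ball 0 1" if "w \<in> ball 0 r" for w
        using f in_dom[of w] that r by (force simp: holomorphic_to_disc_def)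
    qed (use r in auto)
    then show "r * norm (F z (D 0)) \<le> 1" using r by (simp add: d0 field_simps)
  qed
  moreover have z: "z \<in> \<Omega>" using in_dom[OF zero] assms(3) by simp
  have "frechet_derivative f (at z) X = t * F z (D 0)"
    using F(2)[OF z, of t "D 0"] X by (simp add: D_def flip: frechet_derivative_at[OF F(1)[OF z]])
  ultimately show ?thesis by (simp add: norm_mult mult_left_le)
qed

text \<open>
  The competitor is the Cayley map \<open>(h - \<delta>) / (h + \<delta>)\<close>, where \<open>h\<close> is the complex coordinate of the inner
  normal direction: it has positive real part on the half-space and equals \<open>\<delta>\<close> at the given point.
\<close>

lemma half_space_caratheodory_candidate:
  fixes \<Omega> :: "(complex^'n) set"
  assumes n: "norm n = 1" and half: "\<And>w. w \<in> \<Omega> \<Longrightarrow> (w - q) \<bullet> n < 0"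
    and "0 < \<delta>" and z: "q - \<delta> *\<^sub>R n \<in> \<Omega>"
  obtains f where "f \<in> holomorphic_to_disc \<Omega>"
    "\<And>X. norm (frechet_derivative f (at (q - \<delta> *\<^sub>R n)) X) = cmod (complex_coordinate n X) / (2 * \<delta>)"
proof -
  interpret cc: bounded_linear "complex_coordinate n" by (rule bounded_linear_complex_coordinate)
  define h where "h = (\<lambda>w. - complex_coordinate n (w - q))"
  define f where "f = (\<lambda>w. (h w - of_real \<delta>) / (h w + of_real \<delta>))"
  have Re_h: "Re (h w) > 0" if "w \<in> \<Omega>" for w
    using half[OF that] by (simp add: h_def complex_coordinate_def)
  have nz: "h w + of_real \<delta> \<noteq> 0" if "w \<in> \<Omega>" for w
    using Re_h[OF that] assms(3) by (auto simp: complex_eq_iff)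
  have der: "(f has_derivative (\<lambda>v. 2 * of_real \<delta> / (h w + of_real \<delta>)\<^sup>2 * - complex_coordinate n v)) (at w)"
    if "w \<in> \<Omega>" for w
  proof -
    have 1: "(h has_derivative (\<lambda>v. - complex_coordinate n v)) (at w)"
      unfolding h_def by (auto intro!: derivative_eq_intros cc.has_derivative)
    have "((\<lambda>u. (u - of_real \<delta>) / (u + of_real \<delta>)) has_field_derivative
        2 * of_real \<delta> / (h w + of_real \<delta>)\<^sup>2) (at (h w))"
      using nz[OF that] by (auto intro!: derivative_eq_intros simp: field_simps power2_eq_square)
    from has_derivative_compose[OF 1 this[unfolded has_field_derivative_def]]
    show ?thesis unfolding f_def .
  qed
  have "f w \<in> ball 0 1" if "w \<in> \<Omega>" for w
  proof -
    have "(cmod (h w - of_real \<delta>))\<^sup>2 < (cmod (h w + of_real \<delta>))\<^sup>2"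
      unfolding cmod_power2 using Re_h[OF that] assms(3) by (simp add: power2_eq_square algebra_simps)
    then have "cmod (h w - of_real \<delta>) < cmod (h w + of_real \<delta>)" by (rule power_less_imp_less_base) simp
    then show ?thesis using nz[OF that] by (simp add: f_def norm_divide)
  qed
  moreover have "\<exists>f'. (f has_derivative f') (at w) \<and> (\<forall>c v. f' (c *s v) = c * f' v)" if "w \<in> \<Omega>" for w
    using der[OF that] by (intro exI conjI) (auto simp: complex_coordinate_scale)
  ultimately have "f \<in> holomorphic_to_disc \<Omega>" by (auto simp: holomorphic_to_disc_def)
  moreover have "norm (frechet_derivative f (at (q - \<delta> *\<^sub>R n)) X) = cmod (complex_coordinate n X) / (2 * \<delta>)" for X
  proof -
    have "h (q - \<delta> *\<^sub>R n) = of_real \<delta>"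
      using n unfolding h_def scale_of_real[symmetric]
      by (simp add: cc.neg complex_coordinate_scale complex_coordinate_self)
    then have "2 * of_real \<delta> / (h (q - \<delta> *\<^sub>R n) + of_real \<delta>)\<^sup>2 = complex_of_real (1 / (2 * \<delta>))"
      using assms(3) by (simp add: field_simps power2_eq_square)
    then show ?thesis
      unfolding frechet_derivative_at[OF der[OF z], symmetric]
      using assms(3) by (simp only: norm_mult norm_minus_cancel norm_of_real) simp
  qed
  ultimately show thesis by (rule that)
qed

text \<open>
  In the product, discs may be chosen separately in the two factors. In the normal factor
  \<open>\<bar>c - R\<bar> < R\<close> take a Moebius image of the unit disc with centre \<open>\<delta>\<close>, whose derivative at \<open>0\<close> can be any
  number of modulus at most \<open>2\<delta> - \<delta>\<^sup>2/R\<close>; in the tangential ball take a linear disc. The bound rests on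
  \<open>1 / (2\<delta> - \<delta>\<^sup>2/R) \<le> 1 / (2\<delta>) + 1 / (2R)\<close> for \<open>0 < \<delta> \<le> R\<close>.
\<close>

lemma product_kobayashi_candidate:
  fixes \<Omega> :: "(complex^'n) set"
  assumes n: "norm n = 1" and "0 < \<delta>" "\<delta> \<le> R" "0 < r"
    and prod: "\<And>c Y. \<lbrakk>c \<in> ball (of_real R) R; Y \<in> complex_orthogonal n; norm Y \<le> r\<rbrakk>
      \<Longrightarrow> q - c *s n + Y \<in> \<Omega>"
  obtains t \<phi> where "\<phi> \<in> holomorphic_from_disc \<Omega>" "\<phi> 0 = q - \<delta> *\<^sub>R n"
    "t *s (\<chi> i. deriv (\<lambda>\<zeta>. \<phi> \<zeta> $ i) 0) = X"
    "norm t \<le> cmod (complex_coordinate n X) / (2 * \<delta>) + (1 / R + 3 / r) * norm X"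
proof -
  define b where "b = complex_coordinate n X"
  define T where "T = X - b *s n"
  have R: "R > 0" using assms(2,3) by simp
  have T: "T \<in> complex_orthogonal n"
    unfolding T_def b_def by (rule diff_complex_projection_orthogonal[OF n])
  have bX: "cmod b \<le> 2 * norm X"
  proof -
    have "cmod b \<le> \<bar>X \<bullet> n\<bar> + \<bar>X \<bullet> (\<i> *s n)\<bar>"
      using cmod_le[of b] by (simp add: b_def complex_coordinate_def)
    then show ?thesis
      using Cauchy_Schwarz_ineq2[of X n] Cauchy_Schwarz_ineq2[of X "\<i> *s n"] n by simp
  qed
  have TX: "norm T \<le> 3 * norm X"
    using norm_triangle_ineq4[of X "b *s n"] bX n by (simp add: T_def norm_complex_scale)
  define w where "w = 1 - \<delta> / R"
  have w: "0 \<le> w" "w < 1" using assms(2,3) R by (auto simp: w_def)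
  \<comment> \<open>\<open>R (1 - w\<^sup>2)\<close> is the largest derivative at \<open>0\<close> of a disc with centre \<open>\<delta>\<close>.\<close>
  have w2: "R * (1 - w\<^sup>2) = 2 * \<delta> - \<delta>\<^sup>2 / R"
    using R by (simp add: w_def power2_eq_square field_simps)
  have w2pos: "R * (1 - w\<^sup>2) > 0" using w R by (simp add: power_less_one_iff abs_square_less_1)
  have w2bound: "1 / (R * (1 - w\<^sup>2)) \<le> 1 / (2 * \<delta>) + 1 / (2 * R)"
  proof -
    have "0 \<le> \<delta> * (R - \<delta>) / (2 * R\<^sup>2)" using assms(2,3) by simp
    also have "\<delta> * (R - \<delta>) / (2 * R\<^sup>2) = (1 / (2 * \<delta>) + 1 / (2 * R)) * (2 * \<delta> - \<delta>\<^sup>2 / R) - 1"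
      using R assms(2) by (simp add: field_simps power2_eq_square)
    finally show ?thesis using w2pos unfolding w2 by (simp add: pos_divide_le_eq)
  qed
  \<comment> \<open>The larger of the two summands would do; the sum avoids a case distinction.\<close>
  define \<tau> where "\<tau> = cmod b / (R * (1 - w\<^sup>2)) + norm T / r"
  have "cmod b * (1 / (R * (1 - w\<^sup>2))) \<le> cmod b * (1 / (2 * \<delta>) + 1 / (2 * R))"
    using w2bound by (rule mult_left_mono) simp
  moreover have "cmod b / (2 * R) \<le> norm X / R" using bX R by (simp add: field_simps)
  moreover have "norm T / r \<le> 3 * norm X / r" using TX assms(4) by (simp add: divide_right_mono)
  ultimately have \<tau>_le: "\<tau> \<le> cmod b / (2 * \<delta>) + (1 / R + 3 / r) * norm X"
    by (simp add: \<tau>_def algebra_simps)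
  show thesis
  proof (cases "X = 0")
    case True
    have "complex_of_real \<delta> \<in> ball (of_real R) R"
      using assms(2,3) by (simp add: dist_norm norm_of_real flip: of_real_diff)
    from prod[OF this, of 0] have "q - \<delta> *\<^sub>R n \<in> \<Omega>"
      using assms(4) by (simp add: scale_of_real complex_orthogonal_def)
    then show thesis
      using True R assms(2,4) by (intro that[of "\<lambda>_. q - \<delta> *\<^sub>R n" 0]) (auto simp: holomorphic_from_disc_def)
  next
    case False
    have "\<tau> > 0"
    proof -
      have "b \<noteq> 0 \<or> T \<noteq> 0" using False by (auto simp: T_def)
      moreover have "0 \<le> cmod b / (R * (1 - w\<^sup>2))" "b \<noteq> 0 \<Longrightarrow> 0 < cmod b / (R * (1 - w\<^sup>2))"
        using w2pos by (auto intro: divide_pos_pos simp del: zero_less_mult_iff mult_pos_pos)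
      moreover have "0 \<le> norm T / r" "T \<noteq> 0 \<Longrightarrow> 0 < norm T / r" using assms(4) by auto
      ultimately show ?thesis unfolding \<tau>_def by linarith
    qed
    \<comment> \<open>Scales and rotates the parameter of the Moebius disc, so that its derivative becomes \<open>- b / \<tau>\<close>.\<close>
    define l where "l = - b / of_real (\<tau> * (R * (1 - w\<^sup>2)))"
    have l: "cmod l \<le> 1"
    proof -
      have "cmod b / (R * (1 - w\<^sup>2)) \<le> \<tau>" using assms(4) by (simp add: \<tau>_def)
      then have "cmod b \<le> \<tau> * (R * (1 - w\<^sup>2))" using w2pos by (simp add: pos_divide_le_eq)
      moreover have "cmod l = cmod b / (\<tau> * (R * (1 - w\<^sup>2)))"
        unfolding l_def norm_divide norm_minus_cancel norm_of_real using \<open>\<tau> > 0\<close> w2pos by simp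
      moreover have "\<tau> * (R * (1 - w\<^sup>2)) > 0" using \<open>\<tau> > 0\<close> w2pos by simp
      ultimately show ?thesis by (simp only: divide_le_eq_1_pos)
    qed
    define Y where "Y = (1 / \<tau>) *\<^sub>R T"
    have Y: "norm Y \<le> r" "Y \<in> complex_orthogonal n"
    proof -
      have "norm T / r \<le> \<tau>" using w2pos by (simp add: \<tau>_def)
      then show "norm Y \<le> r" using \<open>\<tau> > 0\<close> assms(4) by (simp add: Y_def field_simps)
      show "Y \<in> complex_orthogonal n" using T by (simp add: Y_def complex_orthogonal_def)
    qed
    define \<psi> where "\<psi> = (\<lambda>\<zeta>. of_real R + of_real R * Moebius_function 0 (of_real w) (l * \<zeta>))"
    have cw: "cmod (of_real w) < 1" using w by simp
    have l\<zeta>: "cmod (l * \<zeta>) < 1" if "\<zeta> \<in> ball 0 1" for \<zeta>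
    proof -
      have "cmod (l * \<zeta>) \<le> cmod \<zeta>" using l by (simp add: norm_mult mult_left_le_one_le)
      then show ?thesis using that by simp
    qed
    have \<psi>_ball: "\<psi> \<zeta> \<in> ball (of_real R) R" if "\<zeta> \<in> ball 0 1" for \<zeta>
      using Moebius_function_norm_lt_1[OF cw l\<zeta>[OF that], of 0] R
      by (simp add: \<psi>_def dist_norm norm_mult)
    have "(\<lambda>\<zeta>. Moebius_function 0 (of_real w) (l * \<zeta>)) holomorphic_on ball 0 1"
      using holomorphic_on_compose_gen[OF _ Moebius_function_holomorphic[OF cw], of "\<lambda>\<zeta>. l * \<zeta>" "ball 0 1" 0] l\<zeta>
      by (force simp: o_def intro: holomorphic_intros)
    then have \<psi>_hol: "\<psi> holomorphic_on ball 0 1" unfolding \<psi>_def by (intro holomorphic_intros)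
    have \<psi>0: "\<psi> 0 = of_real \<delta>"
      using R by (simp add: \<psi>_def Moebius_function_of_zero w_def field_simps)
    have \<psi>_deriv: "(\<psi> has_field_derivative (of_real (R * (1 - w\<^sup>2)) * l)) (at 0)"
      unfolding \<psi>_def Moebius_function_simple
      by (auto intro!: derivative_eq_intros simp: power2_eq_square algebra_simps)
    define \<phi> where "\<phi> = (\<lambda>\<zeta>. q - \<psi> \<zeta> *s n + \<zeta> *s Y)"
    show thesis
    proof (rule that[of \<phi> "of_real \<tau>"])
      have "\<phi> \<zeta> \<in> \<Omega>" if "\<zeta> \<in> ball 0 1" for \<zeta>
      proof -
        have "norm (\<zeta> *s Y) \<le> norm Y" using that by (simp add: norm_complex_scale mult_left_le_one_le)
        then show ?thesis
          unfolding \<phi>_def using Y by (intro prod \<psi>_ball that complex_orthogonal_scale) auto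
      qed
      then show "\<phi> \<in> holomorphic_from_disc \<Omega>"
        unfolding holomorphic_from_disc_def
        by (auto simp: \<phi>_def intro!: holomorphic_intros \<psi>_hol)
      show "\<phi> 0 = q - \<delta> *\<^sub>R n" by (simp add: \<phi>_def \<psi>0 scale_of_real)
      have \<tau>l: "of_real \<tau> * (of_real (R * (1 - w\<^sup>2)) * l) = - b"
      proof -
        have "of_real \<tau> * (of_real K * (- b / of_real (\<tau> * K))) = - b" if "K > 0" for K :: real
          using that \<open>\<tau> > 0\<close> by (simp add: field_simps)
        from this[OF w2pos] show ?thesis unfolding l_def .
      qed
      have \<phi>_deriv: "deriv (\<lambda>\<zeta>. \<phi> \<zeta> $ i) 0 = - (of_real (R * (1 - w\<^sup>2)) * l) * n $ i + Y $ i" for i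
        unfolding \<phi>_def
        by (rule DERIV_imp_deriv) (auto intro!: derivative_eq_intros \<psi>_deriv)
      have "(of_real \<tau> *s (\<chi> i. deriv (\<lambda>\<zeta>. \<phi> \<zeta> $ i) 0)) $ i
          = - (of_real \<tau> * (of_real (R * (1 - w\<^sup>2)) * l)) * n $ i + of_real \<tau> * Y $ i" for i
        unfolding vector_smult_component vec_lambda_beta \<phi>_deriv by (simp add: algebra_simps)
      moreover have "of_real \<tau> * Y $ i = T $ i" for i
      proof -
        have "of_real \<tau> * Y $ i = \<tau> *\<^sub>R Y $ i" by (rule scaleR_conv_of_real[symmetric])
        then show ?thesis using \<open>\<tau> > 0\<close> by (simp add: Y_def)
      qed
      ultimately show "of_real \<tau> *s (\<chi> i. deriv (\<lambda>\<zeta>. \<phi> \<zeta> $ i) 0) = X"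
        unfolding vec_eq_iff \<tau>l by (simp add: T_def)
      show "norm (complex_of_real \<tau>) \<le> cmod (complex_coordinate n X) / (2 * \<delta>) + (1 / R + 3 / r) * norm X"
        using \<tau>_le \<open>\<tau> > 0\<close> by (simp add: b_def)
    qed
  qed
qed

section \<open>A supported Levi-flat boundary\<close>

text \<open>
  The local situation at \<open>p\<close>, with gradient \<open>g\<close> and Hessian \<open>H\<close> of the defining function \<open>\<rho>\<close>. The ball has
  radius \<open>4\<epsilon>\<close> so that from boundary points within \<open>\<epsilon>\<close> of \<open>p\<close> one can move by \<open>\<epsilon>\<close> in the tangential and
  then in the normal direction without leaving it. The gradient varies little enough that all normals in
  the ball are transversal to all boundary pieces in it.
\<close>

locale supported_levi_flat_boundary =
  fixes \<Omega> :: "(complex^'n) set" and p :: "complex^'n" and \<rho> :: "complex^'n \<Rightarrow> real"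
    and g :: "complex^'n \<Rightarrow> complex^'n" and H :: "complex^'n \<Rightarrow> complex^'n \<Rightarrow> complex^'n"
    and \<epsilon> M :: real
  assumes open_domain: "open \<Omega>" and connected_domain: "connected \<Omega>"
    and eps_pos: "0 < \<epsilon>" and M_pos: "0 < M"
    and gradient: "x \<in> ball p (4 * \<epsilon>) \<Longrightarrow> (\<rho> has_derivative (\<lambda>v. g x \<bullet> v)) (at x)"
    and hessian: "x \<in> ball p (4 * \<epsilon>) \<Longrightarrow> (g has_derivative H x) (at x)"
    and hessian_bound: "x \<in> ball p (4 * \<epsilon>) \<Longrightarrow> norm (H x v) \<le> M * norm v"
    and hessian_sym: "x \<in> ball p (4 * \<epsilon>) \<Longrightarrow> H x v \<bullet> w = H x w \<bullet> v"
    and gradient_close: "x \<in> ball p (4 * \<epsilon>) \<Longrightarrow> norm (g x - g p) \<le> norm (g p) / 4"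
    and gradient_nonzero: "g p \<noteq> 0"
    and domain_local: "x \<in> ball p (4 * \<epsilon>) \<Longrightarrow> x \<in> \<Omega> \<longleftrightarrow> \<rho> x < 0"
    and frontier_local: "x \<in> ball p (4 * \<epsilon>) \<Longrightarrow> x \<in> frontier \<Omega> \<longleftrightarrow> \<rho> x = 0"
    and base_point: "\<rho> p = 0"
    and levi_flat: "\<lbrakk>x \<in> ball p (4 * \<epsilon>); \<rho> x = 0; X \<in> complex_orthogonal (g x)\<rbrakk>
      \<Longrightarrow> H x X \<bullet> X + H x (\<i> *s X) \<bullet> (\<i> *s X) = 0"
    and support: "\<lbrakk>x \<in> ball p (4 * \<epsilon>); \<rho> x = 0; w \<bullet> g x = 0\<rbrakk> \<Longrightarrow> x + w \<notin> \<Omega>"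
begin

abbreviation normal :: "complex^'n \<Rightarrow> complex^'n" where "normal x \<equiv> sgn (g x)"

lemma gradient_norm_bounds:
  assumes "x \<in> ball p (4 * \<epsilon>)"
  shows "3 / 4 * norm (g p) \<le> norm (g x)" "norm (g x) \<le> 5 / 4 * norm (g p)" "g x \<noteq> 0"
    "0 < norm (g p)"
  using gradient_close[OF assms] gradient_nonzero norm_triangle_ineq2[of "g x" "g p"]
    norm_triangle_ineq2[of "g p" "g x"] by (auto simp: norm_minus_commute)

lemma norm_normal: "x \<in> ball p (4 * \<epsilon>) \<Longrightarrow> norm (normal x) = 1"
  using gradient_norm_bounds(3) by (simp add: norm_sgn)

lemma gradient_eq_normal: "g x = norm (g x) *\<^sub>R normal x"
  by (cases "g x = 0") (simp_all add: sgn_div_norm)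

lemma gradient_inner_normal:
  assumes "x \<in> ball p (4 * \<epsilon>)" "y \<in> ball p (4 * \<epsilon>)"
  shows "norm (g p) / 4 \<le> g x \<bullet> normal y"
proof -
  have "norm (g x - g y) \<le> norm (g p) / 2"
    using gradient_close[OF assms(1)] gradient_close[OF assms(2)]
      norm_triangle_ineq4[of "g x - g p" "g y - g p"] by simp
  then have "(g y - g x) \<bullet> normal y \<le> norm (g p) / 2"
    using norm_cauchy_schwarz[of "g y - g x" "normal y"] norm_normal[OF assms(2)]
    by (simp add: norm_minus_commute)
  moreover have "g y \<bullet> normal y = norm (g y)"
    using gradient_norm_bounds(3)[OF assms(2)]
    by (simp add: sgn_div_norm dot_square_norm power2_eq_square)
  ultimately show ?thesis
    using gradient_norm_bounds(1)[OF assms(2)] by (simp add: inner_diff_left)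
qed

lemma mean_value:
  assumes "x \<in> ball p (4 * \<epsilon>)" "y \<in> ball p (4 * \<epsilon>)"
  obtains z where "z \<in> ball p (4 * \<epsilon>)" "dist z x \<le> dist y x" "\<rho> y - \<rho> x = g z \<bullet> (y - x)"
  using mean_value_gradient[OF convex_ball gradient assms] by blast

lemma gradient_lipschitz:
  assumes "x \<in> ball p (4 * \<epsilon>)" "y \<in> ball p (4 * \<epsilon>)"
  shows "norm (g x - g y) \<le> M * norm (x - y)"
proof (rule differentiable_bound[OF convex_ball _ _ assms])
  show "(g has_derivative H z) (at z within ball p (4 * \<epsilon>))" if "z \<in> ball p (4 * \<epsilon>)" for z
    using hessian[OF that] by (rule has_derivative_at_withinI)
  show "onorm (H z) \<le> M" if "z \<in> ball p (4 * \<epsilon>)" for z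
    using hessian_bound[OF that] by (intro onorm_le) auto
qed

text \<open>
  The height over the tangent hyperplane does not vanish on the connected set \<open>\<Omega>\<close>, so it has constant
  sign; it is negative at points slightly below \<open>q\<close>.
\<close>

lemma domain_in_half_space:
  assumes q: "q \<in> ball p (4 * \<epsilon>)" "\<rho> q = 0" and w: "w \<in> \<Omega>"
  shows "(w - q) \<bullet> g q < 0"
proof -
  let ?h = "\<lambda>w. (w - q) \<bullet> g q"
  have nz: "?h y \<noteq> 0" if "y \<in> \<Omega>" for y
    using support[OF q, of "y - q"] that by auto
  have conn: "connected (?h ` \<Omega>)"
    by (intro connected_continuous_image connected_domain continuous_intros)
  have "((\<lambda>t. \<rho> (q + t *\<^sub>R g q)) has_real_derivative g q \<bullet> g q) (at 0)"
    using has_real_derivative_along_line[of \<rho> "g q" q 0 "g q"] gradient[OF q(1)] by simp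
  then obtain d where d: "d > 0" "\<And>t. t > 0 \<Longrightarrow> t < d \<Longrightarrow> \<rho> (q - t *\<^sub>R g q) < 0"
    using DERIV_pos_inc_left[of "\<lambda>t. \<rho> (q + t *\<^sub>R g q)" "g q \<bullet> g q" 0] gradient_norm_bounds(3)[OF q(1)] q(2)
    by auto
  obtain e where e: "e > 0" "ball q e \<subseteq> ball p (4 * \<epsilon>)"
    using q(1) open_ball openE by blast
  define t where "t = min (d / 2) (e / (2 * norm (g q)))"
  have gq: "norm (g q) > 0" using gradient_norm_bounds(3)[OF q(1)] by simp
  have t: "t > 0" "t < d" "t * norm (g q) < e"
  proof -
    show "t > 0" "t < d" using d e gq by (auto simp: t_def)
    have "t * norm (g q) \<le> e / (2 * norm (g q)) * norm (g q)" by (intro mult_right_mono) (auto simp: t_def)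
    then show "t * norm (g q) < e" using gq e by simp
  qed
  define y where "y = q - t *\<^sub>R g q"
  have "y \<in> ball q e" using t by (simp add: y_def dist_norm)
  then have "y \<in> ball p (4 * \<epsilon>)" using e by blast
  then have y: "y \<in> \<Omega>" using domain_local[of y] d(2)[OF t(1,2)] unfolding y_def by blast
  have hy: "?h y < 0" using t gq by (simp add: y_def dot_square_norm)
  show ?thesis
  proof (rule ccontr)
    assume "\<not> ?thesis"
    then have "?h w > 0" using nz[OF w] by linarith
    then have "0 \<in> ?h ` \<Omega>"
      using connectedD_interval[OF conn, of "?h y" "?h w" 0] hy w y by (meson imageI less_imp_le)
    then show False using nz by auto
  qed
qed

text \<open>
  Were \<open>H(w,w)\<close> negative, \<open>\<rho>\<close> would become negative along the tangent line \<open>q + t w\<close>, so that \<open>\<Omega>\<close> would meet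
  the tangent hyperplane.
\<close>

lemma hessian_nonneg_on_tangent:
  assumes q: "q \<in> ball p (4 * \<epsilon>)" "\<rho> q = 0" and w: "w \<bullet> g q = 0"
  shows "0 \<le> H q w \<bullet> w"
proof (rule ccontr)
  assume neg: "\<not> ?thesis"
  obtain e where e: "e > 0" "ball q e \<subseteq> ball p (4 * \<epsilon>)"
    using q(1) open_ball openE by blast
  have inball: "q + t *\<^sub>R w \<in> ball p (4 * \<epsilon>)" if "0 \<le> t" "t * norm w < e" for t
    using that e(2) by (auto simp: dist_norm subset_iff)
  have d1: "((\<lambda>t. \<rho> (q + t *\<^sub>R w)) has_real_derivative g (q + t *\<^sub>R w) \<bullet> w) (at t)"
    if "0 \<le> t" "t * norm w < e" for t
    using inball[OF that] by (intro has_real_derivative_along_line gradient)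
  have "((\<lambda>t. q + t *\<^sub>R w) has_derivative (\<lambda>h. h *\<^sub>R w)) (at 0)"
    by (auto intro!: derivative_eq_intros)
  then have "((\<lambda>t. g (q + t *\<^sub>R w)) has_derivative (\<lambda>h. H q (h *\<^sub>R w))) (at 0)"
    by (rule has_derivative_compose) (use hessian[OF q(1)] in simp)
  then have "((\<lambda>t. g (q + t *\<^sub>R w) \<bullet> w) has_derivative (\<lambda>h. H q (h *\<^sub>R w) \<bullet> w)) (at 0)"
    by (rule has_derivative_inner_left)
  moreover have "linear (H q)" using hessian[OF q(1)] has_derivative_linear by blast
  ultimately have d2: "((\<lambda>t. g (q + t *\<^sub>R w) \<bullet> w) has_real_derivative H q w \<bullet> w) (at 0)"
    by (simp add: has_field_derivative_def linear_scale mult.commute[of _ "H q w \<bullet> w"])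
  obtain d where d: "d > 0" "\<And>t. t > 0 \<Longrightarrow> t < d \<Longrightarrow> g (q + t *\<^sub>R w) \<bullet> w < 0"
    using DERIV_neg_dec_right[OF d2] neg w by (auto simp: inner_commute)
  define t where "t = min (d / 2) (e / (2 * (norm w + 1)))"
  have nw: "norm w + 1 > 0" by (smt (verit) norm_ge_zero)
  have t: "t > 0" "t < d" using d e nw by (auto simp: t_def)
  have "t * norm w \<le> t * (norm w + 1)" using t by simp
  also have "\<dots> \<le> e / (2 * (norm w + 1)) * (norm w + 1)"
    using nw by (intro mult_right_mono) (auto simp: t_def)
  also have "\<dots> = e / 2" using nw by (simp add: field_simps)
  also have "\<dots> < e" using e by simp
  finally have te: "t * norm w < e" .
  have te': "s * norm w < e" if "s \<le> t" for s
    using mult_right_mono[OF that, of "norm w"] te by simp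
  obtain s where s: "0 < s" "s < t"
    "\<rho> (q + t *\<^sub>R w) - \<rho> (q + 0 *\<^sub>R w) = (t - 0) * (g (q + s *\<^sub>R w) \<bullet> w)"
    using MVT2[OF t(1), of "\<lambda>t. \<rho> (q + t *\<^sub>R w)", OF d1] te' by (metis less_eq_real_def)
  then have "\<rho> (q + t *\<^sub>R w) < 0" using d(2)[of s] t q by (simp add: mult_pos_neg)
  then have "q + t *\<^sub>R w \<in> \<Omega>" using domain_local[OF inball] te t by simp
  then show False using support[OF q, of "t *\<^sub>R w"] w by simp
qed

text \<open>
  The two nonnegative numbers \<open>H(v,v)\<close> and \<open>H(\<i>v,\<i>v)\<close> have sum zero, so \<open>v\<close> is a null vector of a
  nonnegative form and hence in its kernel.
\<close>

lemma hessian_null_on_complex_tangent: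
  assumes q: "q \<in> ball p (4 * \<epsilon>)" "\<rho> q = 0"
    and v: "v \<in> complex_orthogonal (g q)" and w: "w \<bullet> g q = 0"
  shows "H q v \<bullet> w = 0"
proof -
  interpret Hq: linear "H q" using hessian[OF q(1)] has_derivative_linear by blast
  have tang: "x \<bullet> g q = 0" if "x \<in> complex_orthogonal (g q)" for x
    using that by (simp add: complex_orthogonal_def)
  have vv: "H q v \<bullet> v = 0"
    using levi_flat[OF q v] hessian_nonneg_on_tangent[OF q, of v] tang[OF v]
      hessian_nonneg_on_tangent[OF q, of "\<i> *s v"] tang[OF complex_orthogonal_scale[OF v]]
    by auto
  have "0 \<le> 2 * t * (H q v \<bullet> w) + t\<^sup>2 * (H q w \<bullet> w)" for t
  proof -
    have "0 \<le> H q (v + t *\<^sub>R w) \<bullet> (v + t *\<^sub>R w)"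
      using tang[OF v] w by (intro hessian_nonneg_on_tangent q) (simp add: inner_add_left)
    then show ?thesis
      using hessian_sym[OF q(1), of w v] vv
      by (simp add: Hq.add Hq.scale inner_add_left inner_add_right power2_eq_square algebra_simps)
  qed
  then show ?thesis by (rule quadratic_nonneg_linear_zero)
qed

text \<open>
  In a complex tangent direction the gradient changes only by a multiple of itself: the normal direction
  is stationary.
\<close>

lemma hessian_complex_tangent_parallel:
  assumes q: "q \<in> ball p (4 * \<epsilon>)" "\<rho> q = 0" and v: "v \<in> complex_orthogonal (g q)"
  obtains \<mu> where "H q v = \<mu> *\<^sub>R g q" "\<bar>\<mu>\<bar> \<le> M * norm v / norm (g q)"
proof -
  have gq: "norm (g q) > 0" using gradient_norm_bounds(3)[OF q(1)] by simp
  define \<mu> where "\<mu> = (H q v \<bullet> g q) / (norm (g q))\<^sup>2"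
  define z where "z = H q v - \<mu> *\<^sub>R g q"
  have z: "z \<bullet> g q = 0" using gq by (simp add: z_def \<mu>_def inner_diff_left dot_square_norm)
  then have "H q v \<bullet> z = 0" using hessian_null_on_complex_tangent[OF q v] by simp
  with z have "z \<bullet> z = 0" by (simp add: z_def inner_diff_left inner_diff_right inner_commute)
  then have eq: "H q v = \<mu> *\<^sub>R g q" by (simp add: z_def)
  then have "\<bar>\<mu>\<bar> * norm (g q) \<le> M * norm v" using hessian_bound[OF q(1), of v] by simp
  then show thesis using gq by (intro that[OF eq]) (simp add: pos_le_divide_eq)
qed

section \<open>Complex tangent discs lie in the boundary\<close>

lemma complex_orthogonal_normal:
  "x \<in> ball p (4 * \<epsilon>) \<Longrightarrow> complex_orthogonal (normal x) = complex_orthogonal (g x)"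
  using gradient_norm_bounds(3)[of x] by (simp add: sgn_div_norm complex_orthogonal_scaleR)

text \<open>
  This is the differential inequality behind the Gronwall argument. Let \<open>v\<close> be complex tangent at \<open>q\<close>. The
  vector \<open>m\<close> measures how far the gradient at another boundary point \<open>x\<close> is tilted against the normal \<open>n\<close> at
  \<open>q\<close>, and \<open>w\<close> is the derivative of the gradient when \<open>x\<close> moves along the boundary above \<open>v\<close>. Up to an error
  of size \<open>O(\<parallel>m\<parallel>)\<close> the direction of motion is complex tangent at \<open>x\<close>, where the gradient only changes by a
  multiple of itself. So the tilt changes at a rate \<open>O(\<parallel>m\<parallel>)\<close>.
\<close>

lemma normal_tilt_derivative_bound:
  assumes x: "x \<in> ball p (4 * \<epsilon>)" "\<rho> x = 0" and q: "q \<in> ball p (4 * \<epsilon>)"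
    and v: "v \<in> complex_orthogonal (g q)"
  defines "n \<equiv> normal q"
  defines "m \<equiv> g x - (g x \<bullet> n) *\<^sub>R n"
  defines "w \<equiv> H x (v - ((g x \<bullet> v) / (g x \<bullet> n)) *\<^sub>R n)"
  shows "norm (w - (w \<bullet> n) *\<^sub>R n) \<le> (14 * M * norm v / norm (g p)) * norm m"
proof -
  interpret Hx: linear "H x" using hessian[OF x(1)] has_derivative_linear by blast
  define a where "a = norm (g p)"
  have a: "a > 0" and gx: "a / 2 \<le> norm (g x)" "norm (g x) > 0"
    using gradient_norm_bounds[OF x(1)] by (auto simp: a_def)
  have inv_gx: "1 / norm (g x) \<le> 2 / a" using a gx by (simp add: field_simps)
  have n: "norm n = 1" using norm_normal[OF q] by (simp add: n_def)
  have gn: "a / 4 \<le> g x \<bullet> n" using gradient_inner_normal[OF x(1) q] by (simp add: a_def n_def)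
  have v': "v \<in> complex_orthogonal n" using v complex_orthogonal_normal[OF q] by (simp add: n_def)
  have vm: "u \<bullet> g x = u \<bullet> m" if "u \<in> complex_orthogonal n" for u
    using that by (simp add: m_def inner_diff_right complex_orthogonal_def)
  define l where "l = normal x"
  \<comment> \<open>The part of \<open>v\<close> that fails to be complex tangent at \<open>x\<close>.\<close>
  define e where "e = complex_coordinate l v *s l"
  have l: "norm l = 1" using norm_normal[OF x(1)] by (simp add: l_def)
  have "u \<bullet> l = (u \<bullet> m) / norm (g x)" if "u \<in> complex_orthogonal n" for u
    using vm[OF that] by (simp add: l_def sgn_div_norm divide_inverse mult.commute)
  then have ul: "\<bar>u \<bullet> l\<bar> \<le> norm u * norm m / norm (g x)" if "u \<in> complex_orthogonal n" for u
    using that Cauchy_Schwarz_ineq2[of u m] by (simp add: divide_right_mono)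
  have "\<bar>v \<bullet> l\<bar> \<le> norm v * norm m / norm (g x)" using ul[OF v'] .
  moreover have "\<bar>v \<bullet> (\<i> *s l)\<bar> \<le> norm v * norm m / norm (g x)"
    using ul[OF complex_orthogonal_scale[OF v'], of \<i>] by (simp add: inner_i_left)
  moreover have "norm e = cmod (complex_coordinate l v)" using l by (simp add: e_def norm_complex_scale)
  ultimately have e1: "norm e \<le> 2 * (norm v * norm m / norm (g x))"
    using cmod_le[of "complex_coordinate l v"] by (simp add: complex_coordinate_def)
  have m_le: "norm m \<le> norm (g x)" unfolding m_def by (rule norm_project_le[OF n])
  have "norm v * norm m / norm (g x) \<le> norm v * 1"
    using m_le gx mult_left_mono[of "norm m / norm (g x)" 1 "norm v"] by simp
  with e1 have e2: "norm e \<le> 2 * norm v" by simp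
  have "norm v * norm m / norm (g x) = (norm v * norm m) * (1 / norm (g x))" by simp
  also have "\<dots> \<le> (norm v * norm m) * (2 / a)" using inv_gx by (intro mult_left_mono) auto
  finally have e3: "norm e \<le> 4 * norm v * norm m / a" using e1 by simp
  \<comment> \<open>The speed in the direction \<open>n\<close> that keeps the motion tangent to the boundary.\<close>
  define s where "s = - (g x \<bullet> v) / (g x \<bullet> n)"
  have "\<bar>s\<bar> = \<bar>v \<bullet> m\<bar> / (g x \<bullet> n)" using vm[OF v'] gn a by (simp add: s_def inner_commute)
  also have "\<dots> \<le> (norm v * norm m) / (a / 4)"
    using gn a Cauchy_Schwarz_ineq2[of v m] by (intro frac_le) auto
  finally have s: "\<bar>s\<bar> \<le> 4 * norm v * norm m / a" by (simp add: mult_ac)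
  have "v - e \<in> complex_orthogonal (g x)"
    using diff_complex_projection_orthogonal[OF l, of v] complex_orthogonal_normal[OF x(1)]
    by (simp add: e_def l_def)
  from hessian_complex_tangent_parallel[OF x this] obtain \<mu>
    where \<mu>: "H x (v - e) = \<mu> *\<^sub>R g x" "\<bar>\<mu>\<bar> \<le> M * norm (v - e) / norm (g x)" .
  have "norm (v - e) \<le> 3 * norm v" using e2 norm_triangle_ineq4[of v e] by simp
  then have "M * norm (v - e) * (1 / norm (g x)) \<le> M * (3 * norm v) * (2 / a)"
    using M_pos a inv_gx by (intro mult_mono) auto
  with \<mu>(2) have \<mu>3: "\<bar>\<mu>\<bar> \<le> 6 * M * norm v / a" by simp
  define w1 where "w1 = H x (e + s *\<^sub>R n)"
  have "v - ((g x \<bullet> v) / (g x \<bullet> n)) *\<^sub>R n = (v - e) + (e + s *\<^sub>R n)" by (simp add: s_def)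
  then have "w = \<mu> *\<^sub>R g x + w1"
    by (simp only: w_def w1_def Hx.add[of "v - e"] \<mu>(1))
  then have "w - (w \<bullet> n) *\<^sub>R n = \<mu> *\<^sub>R m + (w1 - (w1 \<bullet> n) *\<^sub>R n)"
    by (simp add: m_def inner_add_left algebra_simps)
  then have "norm (w - (w \<bullet> n) *\<^sub>R n) \<le> \<bar>\<mu>\<bar> * norm m + norm w1"
    using norm_triangle_ineq[of "\<mu> *\<^sub>R m" "w1 - (w1 \<bullet> n) *\<^sub>R n"] norm_project_le[OF n, of w1] by simp
  also have "\<bar>\<mu>\<bar> * norm m \<le> 6 * M * norm v / a * norm m" using \<mu>3 by (rule mult_right_mono) simp
  also have "norm w1 \<le> M * norm (e + s *\<^sub>R n)" unfolding w1_def by (rule hessian_bound[OF x(1)])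
  also have "\<dots> \<le> M * (8 * norm v * norm m / a)"
    using M_pos e3 s n norm_triangle_ineq[of e "s *\<^sub>R n"] by (intro mult_left_mono) auto
  finally show ?thesis by (simp add: a_def algebra_simps)
qed

text \<open>
  Over the segment from \<open>q\<close> to \<open>q + v\<close> runs a curve \<open>c\<close> in the boundary, a graph in the direction of the
  normal \<open>n\<close> at \<open>q\<close> (implicit function theorem for one variable). The tilt of the gradient along \<open>c\<close>
  vanishes at the start and satisfies a linear differential inequality, so it vanishes throughout. Hence
  the normal is constant along \<open>c\<close>, the height of \<open>c\<close> over the segment is constant, and \<open>c\<close> is the segment.
\<close>

lemma complex_tangent_disc_in_boundary:
  assumes q: "q \<in> ball p \<epsilon>" "\<rho> q = 0" and v: "v \<in> complex_orthogonal (g q)"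
    and small: "norm v \<le> \<epsilon> / 20"
  shows "\<rho> (q + v) = 0" "normal (q + v) = normal q"
proof -
  \<comment> \<open>Slightly larger than the unit interval, so that all derivatives on it are two-sided.\<close>
  define I where "I = {-1<..<2::real}"
  define n where "n = normal q"
  define a where "a = norm (g p)"
  have q4: "q \<in> ball p (4 * \<epsilon>)" using q eps_pos by auto
  have a: "a > 0" using gradient_nonzero by (simp add: a_def)
  have n: "norm n = 1" using norm_normal[OF q4] by (simp add: n_def)
  have gn: "a / 4 \<le> g x \<bullet> n" if "x \<in> ball p (4 * \<epsilon>)" for x
    using gradient_inner_normal[OF that q4] by (simp add: a_def n_def)
  have gv: "\<bar>g x \<bullet> v\<bar> \<le> 5 / 4 * a * norm v" if "x \<in> ball p (4 * \<epsilon>)" for x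
    using gradient_norm_bounds(2)[OF that] Cauchy_Schwarz_ineq2[of "g x" v]
      mult_right_mono[of "norm (g x)" "5 / 4 * a" "norm v"] by (simp add: a_def)
  have tv: "\<bar>t\<bar> * norm v \<le> \<epsilon> / 10" if "t \<in> I" for t
  proof -
    have "\<bar>t\<bar> * norm v \<le> 2 * (\<epsilon> / 20)" using that small eps_pos by (intro mult_mono) (auto simp: I_def)
    then show ?thesis by simp
  qed
  have inball: "q + t *\<^sub>R v + s *\<^sub>R n \<in> ball p (4 * \<epsilon>)" if "t \<in> I" "\<bar>s\<bar> \<le> \<epsilon>" for t s
  proof -
    have "dist p (q + t *\<^sub>R v + s *\<^sub>R n) \<le> dist p q + norm (t *\<^sub>R v + s *\<^sub>R n)"
      using norm_triangle_ineq4[of "p - q" "t *\<^sub>R v + s *\<^sub>R n"] by (simp add: dist_norm algebra_simps)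
    also have "\<dots> < \<epsilon> + (\<epsilon> / 10 + \<epsilon>)"
      using norm_triangle_ineq[of "t *\<^sub>R v" "s *\<^sub>R n"] tv[OF that(1)] that(2) n q(1) by simp
    finally show ?thesis using eps_pos by simp
  qed
  \<comment> \<open>Moving by \<open>\<epsilon>\<close> along the normal outweighs the change of \<open>\<rho>\<close> along the short tangential vector.\<close>
  have "\<exists>s. \<bar>s\<bar> \<le> \<epsilon> \<and> \<rho> (q + t *\<^sub>R v + s *\<^sub>R n) = 0" if t: "t \<in> I" for t
  proof -
    have b0: "q + t *\<^sub>R v \<in> ball p (4 * \<epsilon>)" using inball[OF t, of 0] eps_pos by simp
    obtain z where z: "z \<in> ball p (4 * \<epsilon>)" "\<rho> (q + t *\<^sub>R v) - \<rho> q = g z \<bullet> (q + t *\<^sub>R v - q)"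
      using mean_value[OF q4 b0] by metis
    have "\<bar>\<rho> (q + t *\<^sub>R v)\<bar> = \<bar>t\<bar> * \<bar>g z \<bullet> v\<bar>" using z q(2) by (simp add: abs_mult)
    also have "\<dots> \<le> \<bar>t\<bar> * (5 / 4 * a * norm v)" using gv[OF z(1)] by (intro mult_left_mono) auto
    also have "\<dots> = 5 / 4 * a * (\<bar>t\<bar> * norm v)" by simp
    also have "\<dots> \<le> 5 / 4 * a * (\<epsilon> / 10)" using a tv[OF t] by (intro mult_left_mono) auto
    finally have r0: "\<bar>\<rho> (q + t *\<^sub>R v)\<bar> \<le> a * \<epsilon> / 8" by (simp add: mult.commute)
    have rs: "\<exists>k\<ge>a / 4. \<rho> (q + t *\<^sub>R v + s *\<^sub>R n) = \<rho> (q + t *\<^sub>R v) + s * k" if s_le: "\<bar>s\<bar> \<le> \<epsilon>" for s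
    proof -
      obtain z where z: "z \<in> ball p (4 * \<epsilon>)"
        "\<rho> (q + t *\<^sub>R v + s *\<^sub>R n) - \<rho> (q + t *\<^sub>R v) = g z \<bullet> (q + t *\<^sub>R v + s *\<^sub>R n - (q + t *\<^sub>R v))"
        using mean_value[OF b0 inball[OF t s_le]] by metis
      then show ?thesis using gn[OF z(1)] by (intro exI[of _ "g z \<bullet> n"]) simp
    qed
    have "0 \<le> \<rho> (q + t *\<^sub>R v + \<epsilon> *\<^sub>R n)"
    proof -
      obtain k where k: "k \<ge> a / 4" "\<rho> (q + t *\<^sub>R v + \<epsilon> *\<^sub>R n) = \<rho> (q + t *\<^sub>R v) + \<epsilon> * k"
        using rs[of \<epsilon>] eps_pos by auto
      have "\<epsilon> * (a / 4) \<le> \<epsilon> * k" using k eps_pos by (intro mult_left_mono) auto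
      moreover have "0 < a * \<epsilon>" using a eps_pos by simp
      ultimately show ?thesis using k r0 by (simp add: mult.commute)
    qed
    moreover have "\<rho> (q + t *\<^sub>R v + (- \<epsilon>) *\<^sub>R n) \<le> 0"
    proof -
      obtain k where k: "k \<ge> a / 4" "\<rho> (q + t *\<^sub>R v + (- \<epsilon>) *\<^sub>R n) = \<rho> (q + t *\<^sub>R v) + (- \<epsilon>) * k"
        using rs[of "- \<epsilon>"] eps_pos by auto
      have "\<epsilon> * (a / 4) \<le> \<epsilon> * k" using k eps_pos by (intro mult_left_mono) auto
      moreover have "0 < a * \<epsilon>" using a eps_pos by simp
      ultimately show ?thesis using k r0 by (simp add: mult.commute)
    qed
    moreover have "continuous_on {-\<epsilon>..\<epsilon>} (\<lambda>s. \<rho> (q + t *\<^sub>R v + s *\<^sub>R n))"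
      by (intro continuous_at_imp_continuous_on ballI DERIV_isCont[OF has_real_derivative_along_line[OF gradient]]
          inball t) auto
    ultimately obtain s where "- \<epsilon> \<le> s" "s \<le> \<epsilon>" "\<rho> (q + t *\<^sub>R v + s *\<^sub>R n) = 0"
      using IVT'[of "\<lambda>s. \<rho> (q + t *\<^sub>R v + s *\<^sub>R n)" "- \<epsilon>" 0 \<epsilon>] eps_pos by auto
    then show ?thesis by (intro exI[of _ s]) auto
  qed
  then obtain s where s: "\<And>t. t \<in> I \<Longrightarrow> \<bar>s t\<bar> \<le> \<epsilon>" "\<And>t. t \<in> I \<Longrightarrow> \<rho> (q + t *\<^sub>R v + s t *\<^sub>R n) = 0"
    by metis
  define c where "c = (\<lambda>t. q + t *\<^sub>R v + s t *\<^sub>R n)"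
  have cball: "c t \<in> ball p (4 * \<epsilon>)" and c0: "\<rho> (c t) = 0" if "t \<in> I" for t
    using inball s that by (auto simp: c_def)
  have mv: "\<exists>z. z \<in> ball p (4 * \<epsilon>) \<and> dist z (c t) \<le> dist (c t') (c t) \<and>
      (s t' - s t) * (g z \<bullet> n) = - (t' - t) * (g z \<bullet> v)" if tt: "t \<in> I" "t' \<in> I" for t t'
  proof -
    obtain z where z: "z \<in> ball p (4 * \<epsilon>)" "dist z (c t) \<le> dist (c t') (c t)"
      "\<rho> (c t') - \<rho> (c t) = g z \<bullet> (c t' - c t)"
      using mean_value[OF cball[OF tt(1)] cball[OF tt(2)]] by metis
    have "c t' - c t = (t' - t) *\<^sub>R v + (s t' - s t) *\<^sub>R n" by (simp add: c_def algebra_simps)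
    with z(3) have "0 = (t' - t) * (g z \<bullet> v) + (s t' - s t) * (g z \<bullet> n)"
      using c0 tt by (simp add: inner_add_right)
    with z(1,2) show ?thesis by (intro exI[of _ z]) (simp add: algebra_simps)
  qed
  have s_lip: "\<bar>s t' - s t\<bar> \<le> 5 * norm v * \<bar>t' - t\<bar>" if tt: "t \<in> I" "t' \<in> I" for t t'
  proof -
    obtain z where z: "z \<in> ball p (4 * \<epsilon>)" "(s t' - s t) * (g z \<bullet> n) = - (t' - t) * (g z \<bullet> v)"
      using mv[OF tt] by blast
    have "\<bar>s t' - s t\<bar> * (a / 4) \<le> \<bar>s t' - s t\<bar> * (g z \<bullet> n)" using gn[OF z(1)] by (intro mult_left_mono) auto
    also have "\<dots> = \<bar>(s t' - s t) * (g z \<bullet> n)\<bar>" using gn[OF z(1)] a by (simp add: abs_mult)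
    also have "\<dots> = \<bar>t' - t\<bar> * \<bar>g z \<bullet> v\<bar>" unfolding z(2) by (simp add: abs_mult abs_minus_commute)
    also have "\<dots> \<le> \<bar>t' - t\<bar> * (5 / 4 * a * norm v)" using gv[OF z(1)] by (intro mult_left_mono) auto
    also have "\<dots> = (5 * norm v * \<bar>t' - t\<bar>) * (a / 4)" by simp
    finally show ?thesis using a by simp
  qed
  have c_lip: "dist (c t') (c t) \<le> 6 * norm v * \<bar>t' - t\<bar>" if "t \<in> I" "t' \<in> I" for t t'
  proof -
    have "c t' - c t = (t' - t) *\<^sub>R v + (s t' - s t) *\<^sub>R n" by (simp add: c_def algebra_simps)
    then have "dist (c t') (c t) \<le> \<bar>t' - t\<bar> * norm v + \<bar>s t' - s t\<bar>"
      using norm_triangle_ineq[of "(t' - t) *\<^sub>R v" "(s t' - s t) *\<^sub>R n"] n by (simp add: dist_norm)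
    moreover have "6 * norm v * \<bar>t' - t\<bar> = \<bar>t' - t\<bar> * norm v + 5 * norm v * \<bar>t' - t\<bar>" by simp
    ultimately show ?thesis using s_lip[OF that] by linarith
  qed
  define s' where "s' = (\<lambda>t. - (g (c t) \<bullet> v) / (g (c t) \<bullet> n))"
  \<comment> \<open>The mean value theorem gives the difference quotients of \<open>s\<close> as a continuous expression in a point that tends to \<open>c t\<close>.\<close>
  have s_deriv: "(s has_real_derivative s' t) (at t)" if t: "t \<in> I" for t
  proof -
    have "\<forall>t'. \<exists>z. t' \<in> I \<longrightarrow> z \<in> ball p (4 * \<epsilon>) \<and> dist z (c t) \<le> dist (c t') (c t) \<and>
      (s t' - s t) * (g z \<bullet> n) = - (t' - t) * (g z \<bullet> v)" using mv[OF t] by blast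
    then obtain Z where Z: "\<And>t'. t' \<in> I \<Longrightarrow> Z t' \<in> ball p (4 * \<epsilon>)"
      "\<And>t'. t' \<in> I \<Longrightarrow> dist (Z t') (c t) \<le> dist (c t') (c t)"
      "\<And>t'. t' \<in> I \<Longrightarrow> (s t' - s t) * (g (Z t') \<bullet> n) = - (t' - t) * (g (Z t') \<bullet> v)" by metis
    have evI: "\<forall>\<^sub>F t' in at t. t' \<in> I"
      using t eventually_at_in_open'[of I t] by (simp add: I_def)
    have "((\<lambda>t'. 6 * norm v * t') \<longlongrightarrow> 6 * norm v * t) (at t)" by (intro tendsto_intros)
    moreover have "\<forall>\<^sub>F t' in at t. dist (Z t') (c t) \<le> dist (6 * norm v * t') (6 * norm v * t)"
      using evI
    proof eventually_elim
      case (elim t')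
      have "dist (6 * norm v * t') (6 * norm v * t) = \<bar>6 * norm v * (t' - t)\<bar>"
        by (simp add: dist_real_def right_diff_distrib)
      then show ?case using Z(2)[OF elim] c_lip[OF t elim] by (simp add: abs_mult)
    qed
    ultimately have Zlim: "(Z \<longlongrightarrow> c t) (at t)" by (rule metric_tendsto_imp_tendsto)
    have "isCont g (c t)" using hessian[OF cball[OF t]] by (rule has_derivative_continuous)
    from isCont_tendsto_compose[OF this Zlim] have "((\<lambda>t'. g (Z t')) \<longlongrightarrow> g (c t)) (at t)" .
    then have "((\<lambda>t'. - (g (Z t') \<bullet> v) / (g (Z t') \<bullet> n)) \<longlongrightarrow> s' t) (at t)"
      unfolding s'_def using gn[OF cball[OF t]] a by (intro tendsto_intros) auto
    moreover have "\<forall>\<^sub>F t' in at t. - (g (Z t') \<bullet> v) / (g (Z t') \<bullet> n) = (s t' - s t) / (t' - t)"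
      using evI eventually_neq_at_within[of t t UNIV]
    proof eventually_elim
      case (elim t')
      then show ?case using Z(3)[OF elim(1)] gn[OF Z(1)[OF elim(1)]] a by (simp add: field_simps)
    qed
    ultimately show ?thesis
      unfolding has_field_derivative_iff by (rule Lim_transform_eventually)
  qed
  define m where "m = (\<lambda>t. g (c t) - (g (c t) \<bullet> n) *\<^sub>R n)"
  define w where "w = (\<lambda>t. H (c t) (v - ((g (c t) \<bullet> v) / (g (c t) \<bullet> n)) *\<^sub>R n))"
  have m_deriv: "(m has_vector_derivative (w t - (w t \<bullet> n) *\<^sub>R n)) (at t)" if t: "t \<in> I" for t
  proof -
    have "linear (H (c t))" using hessian[OF cball[OF t]] has_derivative_linear by blast
    have "(c has_derivative (\<lambda>h. h *\<^sub>R (v - ((g (c t) \<bullet> v) / (g (c t) \<bullet> n)) *\<^sub>R n))) (at t)"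
      unfolding c_def
      by (rule derivative_eq_intros s_deriv[OF t, unfolded has_field_derivative_def] refl)+
        (auto simp: s'_def c_def algebra_simps)
    from has_derivative_compose[OF this hessian[OF cball[OF t]]]
    have gc: "((\<lambda>t. g (c t)) has_derivative (\<lambda>h. h *\<^sub>R w t)) (at t)"
      using linear_scale[OF \<open>linear (H (c t))\<close>] by (simp add: w_def)
    show ?thesis
      unfolding m_def has_vector_derivative_def
      by (rule derivative_eq_intros gc refl)+ (auto simp: algebra_simps)
  qed
  have qn: "g q = norm (g q) *\<^sub>R n" unfolding n_def by (rule gradient_eq_normal)
  have s00: "s 0 = 0"
  proof -
    have I0: "0 \<in> I" by (simp add: I_def)
    obtain z where z: "z \<in> ball p (4 * \<epsilon>)" "\<rho> (c 0) - \<rho> q = g z \<bullet> (c 0 - q)"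
      using mean_value[OF q4 cball[OF I0]] by metis
    then have "s 0 * (g z \<bullet> n) = 0" using c0[OF I0] q(2) by (simp add: c_def)
    then show ?thesis using gn[OF z(1)] a by simp
  qed
  have m0: "m t = 0" if "t \<in> {0..1}" for t
  proof (rule gronwall_zero[OF _ _ _ that])
    fix t :: real assume "t \<in> {0..1}"
    then have t: "t \<in> I" by (simp add: I_def)
    show "(m has_vector_derivative (w t - (w t \<bullet> n) *\<^sub>R n)) (at t)" by (rule m_deriv[OF t])
    show "norm (w t - (w t \<bullet> n) *\<^sub>R n) \<le> (14 * M * norm v / norm (g p)) * norm (m t)"
      unfolding w_def m_def n_def by (rule normal_tilt_derivative_bound[OF cball[OF t] c0[OF t] q4 v])
  next
    have "n \<bullet> n = 1" using n by (simp add: dot_square_norm)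
    then show "m 0 = 0" using s00 by (subst m_def, simp add: c_def) (subst (1 2) qn, simp)
  qed
  have vn: "v \<bullet> n = 0"
    using v complex_orthogonal_normal[OF q4] by (auto simp: n_def complex_orthogonal_def)
  have "s' t = 0" if "t \<in> {0..1}" for t
  proof -
    have "g (c t) = (g (c t) \<bullet> n) *\<^sub>R n" using m0[OF that] by (simp add: m_def)
    then have "g (c t) \<bullet> v = 0" using vn by (metis inner_commute inner_scaleR_left mult_zero_right)
    then show ?thesis by (simp add: s'_def)
  qed
  moreover obtain t where "0 < t" "t < 1" "s 1 - s 0 = (1 - 0) * s' t"
    using MVT2[of 0 1 s s'] s_deriv by (auto simp: I_def)
  ultimately have "s 1 = 0" using s00 by simp
  then have c1: "c 1 = q + v" by (simp add: c_def)
  have I1: "1 \<in> I" by (simp add: I_def)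
  show "\<rho> (q + v) = 0" using c0[OF I1] c1 by simp
  have "g (c 1) = (g (c 1) \<bullet> n) *\<^sub>R n" using m0[of 1] by (simp add: m_def)
  then have "normal (c 1) = sgn (g (c 1) \<bullet> n) *\<^sub>R sgn n" by (metis sgn_scaleR)
  moreover have "g (c 1) \<bullet> n > 0" using gn[OF cball[OF I1]] a by simp
  moreover have "sgn n = n" using n by (simp add: sgn_div_norm)
  ultimately have "normal (q + v) = n" using c1 by simp
  then show "normal (q + v) = normal q" by (simp only: n_def)
qed

section \<open>A product of a disc and a ball inside the domain\<close>

text \<open>
  Radius of the interior balls: where the Hessian is at most \<open>M\<close>, the sphere is curved more strongly than
  the boundary.
\<close>

definition radius :: real where
  "radius = min \<epsilon> (norm (g p) / (4 * M))"

lemma radius_pos: "0 < radius" and radius_le: "radius \<le> \<epsilon>" "4 * M * radius \<le> norm (g p)"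
proof -
  show "0 < radius" using eps_pos M_pos gradient_nonzero by (simp add: radius_def)
  show "radius \<le> \<epsilon>" by (simp add: radius_def)
  have "radius \<le> norm (g p) / (4 * M)" by (simp add: radius_def)
  then show "4 * M * radius \<le> norm (g p)" using M_pos by (simp add: field_simps)
qed

lemma ball_subset_chart: "x \<in> ball p \<epsilon> \<Longrightarrow> x \<in> ball p (4 * \<epsilon>)"
  "x \<in> ball p (2 * \<epsilon>) \<Longrightarrow> x \<in> ball p (4 * \<epsilon>)"
  using eps_pos by auto

text \<open>
  A point \<open>x + u\<close> of the ball satisfies \<open>\<parallel>u\<parallel>\<^sup>2 < - 2 R (u \<bullet> n)\<close>, where \<open>R\<close> is the radius,
  so the negative first-order term of \<open>\<rho>\<close>
  dominates the second-order error \<open>M \<parallel>u\<parallel>\<^sup>2\<close>.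
\<close>

lemma interior_ball:
  assumes x: "x \<in> ball p (2 * \<epsilon>)" "\<rho> x = 0" and y: "dist y (x - radius *\<^sub>R normal x) < radius"
  shows "y \<in> \<Omega>"
proof -
  have x4: "x \<in> ball p (4 * \<epsilon>)" using ball_subset_chart x by blast
  define u where "u = y - x"
  define n where "n = normal x"
  have n: "norm n = 1" using norm_normal[OF x4] by (simp add: n_def)
  have un: "norm (u + radius *\<^sub>R n) < radius" using y by (simp add: u_def n_def dist_norm diff_diff_eq2 diff_add_eq)
  have "norm u \<le> norm (u + radius *\<^sub>R n) + norm (radius *\<^sub>R n)"
    using norm_triangle_ineq4[of "u + radius *\<^sub>R n" "radius *\<^sub>R n"] by simp
  then have "dist x y < 2 * \<epsilon>"
    using un n radius_pos radius_le(1) by (simp add: u_def dist_norm norm_minus_commute)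
  then have y4: "y \<in> ball p (4 * \<epsilon>)" using x(1) dist_triangle[of p y x] by simp
  have "(norm (u + radius *\<^sub>R n))\<^sup>2 < radius\<^sup>2" using un by (intro power_strict_mono) auto
  moreover have "(norm (u + radius *\<^sub>R n))\<^sup>2 = (norm u)\<^sup>2 + 2 * radius * (u \<bullet> n) + radius\<^sup>2"
  proof -
    have "n \<bullet> n = 1" using n by (simp add: dot_square_norm)
    then show ?thesis
      unfolding power2_norm_eq_inner
      by (simp add: inner_add_left inner_add_right inner_commute[of n u] power2_eq_square algebra_simps)
  qed
  ultimately have "(norm u)\<^sup>2 < 2 * radius * - (u \<bullet> n)" by simp
  then have uu: "(norm u)\<^sup>2 / (2 * radius) < - (u \<bullet> n)" using radius_pos by (simp add: pos_divide_less_eq mult.commute)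
  obtain z where z: "z \<in> ball p (4 * \<epsilon>)" "dist z x \<le> dist y x" "\<rho> y - \<rho> x = g z \<bullet> (y - x)"
    using mean_value[OF x4 y4] .
  have "(g z - g x) \<bullet> u \<le> norm (g z - g x) * norm u" by (rule norm_cauchy_schwarz)
  also have "\<dots> \<le> (M * norm u) * norm u"
  proof (rule mult_right_mono)
    have "norm (g z - g x) \<le> M * norm (z - x)" by (rule gradient_lipschitz[OF z(1) x4])
    also have "\<dots> \<le> M * norm u" using z(2) M_pos by (intro mult_left_mono) (auto simp: u_def dist_norm)
    finally show "norm (g z - g x) \<le> M * norm u" .
  qed simp
  finally have 1: "(g z - g x) \<bullet> u \<le> M * (norm u)\<^sup>2" by (simp add: power2_eq_square)
  have gx: "norm (g x) \<ge> 2 * M * radius" "norm (g x) > 0"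
    using gradient_norm_bounds[OF x4] radius_le(2) by auto
  have "M * (norm u)\<^sup>2 = (2 * M * radius) * ((norm u)\<^sup>2 / (2 * radius))" using radius_pos by simp
  also have "\<dots> \<le> norm (g x) * ((norm u)\<^sup>2 / (2 * radius))"
    using gx radius_pos by (intro mult_right_mono) auto
  also have "\<dots> < norm (g x) * - (u \<bullet> n)" using uu gx by (rule_tac mult_strict_left_mono) auto
  also have "\<dots> = - (g x \<bullet> u)"
    using gradient_eq_normal[of x] by (metis inner_commute inner_scaleR_left mult_minus_right n_def)
  finally have "\<rho> y < 0" using 1 z(3) x(2) by (simp add: inner_diff_left u_def)
  then show ?thesis using domain_local[OF y4] by simp
qed

text \<open>
  As the normal is the same at all points of the flat piece of boundary through \<open>q\<close>, the interior balls at
  these points are translates of each other, and slices of them fill the product.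
\<close>

lemma product_in_domain:
  assumes q: "q \<in> ball p \<epsilon>" "\<rho> q = 0" and c: "c \<in> ball (of_real radius) radius"
    and Y: "Y \<in> complex_orthogonal (normal q)" "norm Y \<le> \<epsilon> / 20"
  shows "q - c *s normal q + Y \<in> \<Omega>"
proof -
  have q4: "q \<in> ball p (4 * \<epsilon>)" using ball_subset_chart q by blast
  have Y': "Y \<in> complex_orthogonal (g q)" using Y complex_orthogonal_normal[OF q4] by simp
  note leaf = complex_tangent_disc_in_boundary[OF q Y' Y(2)]
  have "dist p (q + Y) \<le> dist p q + norm Y"
    using norm_triangle_ineq4[of "p - q" Y] by (simp add: dist_norm algebra_simps)
  then have ball: "q + Y \<in> ball p (2 * \<epsilon>)" using q(1) Y(2) eps_pos by simp
  have eq: "q - c *s normal q + Y - (q + Y - radius *\<^sub>R normal q) = (of_real radius - c) *s normal q"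
    unfolding scale_of_real[symmetric] by (simp add: vec_eq_iff algebra_simps)
  then have "dist (q - c *s normal q + Y) (q + Y - radius *\<^sub>R normal q) = cmod (of_real radius - c)"
    unfolding dist_norm eq norm_complex_scale norm_normal[OF q4] by simp
  then show ?thesis using interior_ball[OF ball leaf(1)] c leaf(2) by (simp add: dist_norm)
qed

section \<open>Projection to the boundary\<close>

lemma gradient_eq:
  assumes "x \<in> ball p (4 * \<epsilon>)"
  shows "Defs.gradient \<rho> x = g x"
  unfolding gradient_def
proof (rule the_equality)
  show "GDERIV \<rho> x :> g x" using gradient[OF assms] by (simp add: gderiv_def inner_commute)
  fix D assume "GDERIV \<rho> x :> D"
  then have "(\<rho> has_derivative (\<lambda>v. D \<bullet> v)) (at x)" by (simp add: gderiv_def inner_commute)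
  from has_derivative_unique[OF this gradient[OF assms]] show "D = g x"
    by (metis vector_eq_rdot inner_commute)
qed

lemma inner_unit_normal_eq: "x \<in> ball p (4 * \<epsilon>) \<Longrightarrow> inner_unit_normal \<rho> x = - normal x"
  by (simp add: inner_unit_normal_def gradient_eq)

lemma complex_tangent_space_eq:
  assumes "x \<in> ball p (4 * \<epsilon>)"
  shows "complex_tangent_space \<rho> x = complex_orthogonal (g x)"
  by (auto simp: complex_tangent_space_def real_tangent_space_def complex_orthogonal_def
      frechet_derivative_at[OF gradient[OF assms], symmetric] inner_commute[of _ "g x"] inner_i_swap[of "g x"])

lemma base_in_frontier: "p \<in> frontier \<Omega>"
  using frontier_local[of p] base_point eps_pos by simp

lemma boundary_distance_le: "boundary_distance \<Omega> z \<le> dist z p"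
  unfolding boundary_distance_def by (rule infdist_le[OF base_in_frontier])

text \<open>
  Take a nearest frontier point \<open>q\<close>. The ball around \<open>z\<close> up to the frontier lies in \<open>\<Omega>\<close>, hence in the
  half-space at \<open>q\<close>, so \<open>z\<close> has distance at least \<open>\<delta> = \<parallel>z - q\<parallel>\<close> to the hyperplane: this is equality in the
  Cauchy-Schwarz inequality, and \<open>z - q\<close> is normal.
\<close>

lemma boundary_projection_exists:
  assumes z: "z \<in> \<Omega>" "dist z p < \<epsilon> / 2"
  obtains q where "q \<in> ball p \<epsilon>" "\<rho> q = 0" "z = q - boundary_distance \<Omega> z *\<^sub>R normal q"
    "0 < boundary_distance \<Omega> z"
proof -
  define \<delta> where "\<delta> = boundary_distance \<Omega> z"
  obtain q where q: "q \<in> frontier \<Omega>" "\<delta> = dist z q"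
    using infdist_attains_inf[of "frontier \<Omega>" z] base_in_frontier
    unfolding \<delta>_def boundary_distance_def by auto
  have \<delta>: "\<delta> < \<epsilon> / 2" using boundary_distance_le[of z] z by (simp add: \<delta>_def)
  have "dist p q \<le> dist z p + dist z q" using dist_triangle[of p q z] by (simp add: dist_commute)
  then have qb: "q \<in> ball p \<epsilon>" using q z \<delta> by simp
  then have q4: "q \<in> ball p (4 * \<epsilon>)" using ball_subset_chart by blast
  then have q0: "\<rho> q = 0" using q frontier_local by blast
  have "z \<notin> frontier \<Omega>" using z open_domain by (simp add: frontier_def interior_open)
  then have \<delta>0: "\<delta> > 0" using q by auto
  have "ball z \<delta> \<inter> frontier \<Omega> = {}"
    using infdist_le[of _ "frontier \<Omega>" z] by (fastforce simp: \<delta>_def boundary_distance_def)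
  moreover have "z \<in> ball z \<delta>" using \<delta>0 by simp
  ultimately have sub: "ball z \<delta> \<subseteq> \<Omega>"
    using connected_Int_frontier[OF connected_ball, of z \<delta> \<Omega>] z(1) by blast
  define n where "n = normal q"
  have n: "norm n = 1" using norm_normal[OF q4] by (simp add: n_def)
  have lt: "(z - q) \<bullet> n < - s * \<delta>" if s: "0 < s" "s < 1" for s
  proof -
    have "z + (s * \<delta>) *\<^sub>R n \<in> ball z \<delta>" using s \<delta>0 n by (simp add: dist_norm)
    then have "(z + (s * \<delta>) *\<^sub>R n - q) \<bullet> g q < 0" using domain_in_half_space[OF q4 q0] sub by blast
    moreover have "g q = norm (g q) *\<^sub>R n" unfolding n_def by (rule gradient_eq_normal)
    then have "(z + (s * \<delta>) *\<^sub>R n - q) \<bullet> g q = norm (g q) * ((z + (s * \<delta>) *\<^sub>R n - q) \<bullet> n)"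
      by (metis inner_scaleR_right)
    ultimately have "(z + (s * \<delta>) *\<^sub>R n - q) \<bullet> n < 0"
      using gradient_norm_bounds(3)[OF q4] by (simp add: mult_less_0_iff)
    moreover have "(z + (s * \<delta>) *\<^sub>R n - q) \<bullet> n = (z - q) \<bullet> n + s * \<delta>"
      using n by (simp add: inner_add_left inner_diff_left dot_square_norm)
    ultimately show ?thesis by simp
  qed
  have "\<delta> \<le> - ((z - q) \<bullet> n)"
    by (rule field_le_mult_one_interval) (use lt in force)
  then have "norm (z - q) * norm (- n) \<le> (z - q) \<bullet> (- n)" using q n by (simp add: dist_norm)
  then have "(z - q) \<bullet> (- n) = norm (z - q) * norm (- n)"
    using norm_cauchy_schwarz[of "z - q" "- n"] by linarith
  then have "norm (z - q) *\<^sub>R (- n) = norm (- n) *\<^sub>R (z - q)" by (simp only: norm_cauchy_schwarz_eq)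
  then have "z - q = - (\<delta> *\<^sub>R n)" using n q by (simp add: dist_norm)
  then have "z = q - \<delta> *\<^sub>R n" by (simp add: algebra_simps)
  then show thesis using that[OF qb q0] \<delta>0 by (simp add: \<delta>_def n_def)
qed

text \<open>
  The normal is Lipschitz, so for small \<open>\<delta>\<close> the map \<open>q \<mapsto> q - \<delta> n\<^sub>q\<close> is injective.
\<close>

lemma normal_foot_unique:
  assumes q1: "q1 \<in> ball p (4 * \<epsilon>)" and q2: "q2 \<in> ball p (4 * \<epsilon>)"
    and \<delta>: "0 \<le> \<delta>" "\<delta> \<le> radius / 2"
    and eq: "q1 - \<delta> *\<^sub>R normal q1 = q2 - \<delta> *\<^sub>R normal q2"
  shows "q1 = q2"
proof (rule ccontr)
  assume "q1 \<noteq> q2"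
  then have d: "norm (q1 - q2) > 0" by simp
  have g1: "norm (g q1) \<ge> 3 / 4 * norm (g p)" "norm (g q1) > 0" "norm (g p) > 0"
    using gradient_norm_bounds[OF q1] by auto
  have "q1 - q2 = \<delta> *\<^sub>R (normal q1 - normal q2)" using eq by (simp add: algebra_simps)
  then have "norm (q1 - q2) = \<delta> * norm (normal q1 - normal q2)" using \<delta> by simp
  also have "\<dots> \<le> \<delta> * (2 * norm (g q1 - g q2) / norm (g q1))"
    using gradient_norm_bounds(3)[OF q1] \<delta> by (intro mult_left_mono norm_sgn_diff_le) auto
  also have "\<dots> \<le> \<delta> * (2 * (M * norm (q1 - q2)) / norm (g q1))"
    using gradient_lipschitz[OF q1 q2] \<delta> by (intro mult_left_mono divide_right_mono) auto
  also have "\<dots> = (2 * M * \<delta>) / norm (g q1) * norm (q1 - q2)" by simp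
  finally have "norm (g q1) \<le> 2 * M * \<delta>" using d g1 by (simp add: field_simps)
  also have "\<dots> \<le> M * radius" using \<delta> M_pos by simp
  also have "\<dots> \<le> norm (g p) / 4" using radius_le(2) by simp
  finally show False using g1 by linarith
qed

text \<open>
  A projection \<open>q'\<close> may a priori lie anywhere on the frontier, where the formal normal has norm \<open>0\<close> or \<open>1\<close>;
  in both cases \<open>q'\<close> is within \<open>\<delta>\<close> of \<open>z\<close> and hence in the ball where the normal is known.
\<close>

lemma boundary_projection_unique:
  assumes z: "z \<in> \<Omega>" "dist z p < radius / 2"
    and q: "q \<in> ball p \<epsilon>" "\<rho> q = 0" "z = q - boundary_distance \<Omega> z *\<^sub>R normal q"
  shows "is_boundary_projection \<Omega> \<rho> z q' \<longleftrightarrow> q' = q"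
proof
  have q4: "q \<in> ball p (4 * \<epsilon>)" using q ball_subset_chart by blast
  show "is_boundary_projection \<Omega> \<rho> z q'" if "q' = q"
    using q frontier_local[OF q4] inner_unit_normal_eq[OF q4] that
    by (simp add: is_boundary_projection_def)
  assume pr: "is_boundary_projection \<Omega> \<rho> z q'"
  define \<delta> where "\<delta> = boundary_distance \<Omega> z"
  have \<delta>: "0 \<le> \<delta>" "\<delta> \<le> radius / 2"
    using boundary_distance_le[of z] z by (auto simp: \<delta>_def boundary_distance_def infdist_nonneg)
  have eq: "z = q' + \<delta> *\<^sub>R inner_unit_normal \<rho> q'"
    using pr by (simp add: is_boundary_projection_def \<delta>_def)
  have "norm (inner_unit_normal \<rho> q') \<le> 1" by (simp add: inner_unit_normal_def norm_sgn)
  moreover have "dist z q' = \<delta> * norm (inner_unit_normal \<rho> q')" using eq \<delta> by (simp add: dist_norm)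
  ultimately have "dist z q' \<le> \<delta>" using \<delta> by (simp add: mult_left_le)
  then have q'4: "q' \<in> ball p (4 * \<epsilon>)"
    using dist_triangle[of p q' z] z(2) \<delta> radius_le(1) eps_pos by (simp add: dist_commute)
  have "z = q' - \<delta> *\<^sub>R normal q'" using eq inner_unit_normal_eq[OF q'4] by simp
  then have "q' - \<delta> *\<^sub>R normal q' = q - \<delta> *\<^sub>R normal q" using q(3) by (simp add: \<delta>_def)
  with normal_foot_unique[OF q'4 q4 \<delta>] show "q' = q" by simp
qed

section \<open>The estimate\<close>

text \<open>
  One competitor from the half-space and one from the product suffice for both metrics, because
  a competitor for the Caratheodory metric never exceeds one for the Kobayashi metric.
\<close>

lemma metric_estimate:
  assumes z: "z \<in> \<Omega>" "dist z p < radius / 2"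
    and \<alpha>: "\<alpha> = caratheodory_metric \<Omega> \<or> \<alpha> = kobayashi_metric \<Omega>"
  shows "\<exists>!q. is_boundary_projection \<Omega> \<rho> z q"
    and "0 \<le> \<alpha> z X - norm (normal_component \<Omega> \<rho> z X) / (2 * boundary_distance \<Omega> z)"
    and "\<alpha> z X - norm (normal_component \<Omega> \<rho> z X) / (2 * boundary_distance \<Omega> z)
      \<le> (1 / radius + 60 / \<epsilon>) * norm X"
proof -
  define \<delta> where "\<delta> = boundary_distance \<Omega> z"
  have "dist z p < \<epsilon> / 2" using z(2) radius_le(1) by simp
  from boundary_projection_exists[OF z(1) this] obtain q where
    q: "q \<in> ball p \<epsilon>" "\<rho> q = 0" "z = q - \<delta> *\<^sub>R normal q" and \<delta>: "0 < \<delta>"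
    unfolding \<delta>_def .
  note proj = boundary_projection_unique[OF z q(1,2) q(3)[unfolded \<delta>_def]]
  show "\<exists>!q. is_boundary_projection \<Omega> \<rho> z q" unfolding proj by simp
  have bp: "boundary_projection \<Omega> \<rho> z = q" unfolding boundary_projection_def proj by simp
  have \<delta>R: "\<delta> \<le> radius" using boundary_distance_le[of z] z radius_pos by (simp add: \<delta>_def)
  define n where "n = normal q"
  have q4: "q \<in> ball p (4 * \<epsilon>)" using q ball_subset_chart by blast
  have n: "norm n = 1" using norm_normal[OF q4] by (simp add: n_def)
  have tan: "complex_tangent_space \<rho> q = complex_orthogonal n"
    using complex_tangent_space_eq[OF q4] complex_orthogonal_normal[OF q4] by (simp add: n_def)
  have "normal_component \<Omega> \<rho> z X = complex_coordinate n X *s n"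
    unfolding normal_component_def bp tan orthogonal_comp_complex_orthogonal[OF n] by simp
  then have XN: "norm (normal_component \<Omega> \<rho> z X) = cmod (complex_coordinate n X)"
    using n by (simp add: norm_complex_scale)
  define C where "C = {norm (frechet_derivative f (at z) X) | f. f \<in> holomorphic_to_disc \<Omega>}"
  define K where "K = {norm t | t :: complex. \<exists>\<phi>\<in>holomorphic_from_disc \<Omega>.
            \<phi> 0 = z \<and> t *s (\<chi> i. deriv (\<lambda>\<zeta>. \<phi> \<zeta> $ i) 0) = X}"
  have CK: "c \<le> k" if "c \<in> C" "k \<in> K" for c k
    using that caratheodory_candidate_le_kobayashi_candidate[where \<Omega> = \<Omega> and z = z and X = X]
    unfolding C_def K_def by blast
  have half: "(w - q) \<bullet> n < 0" if "w \<in> \<Omega>" for w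
  proof -
    have "(w - q) \<bullet> g q < 0" by (rule domain_in_half_space[OF q4 q(2) that])
    then show ?thesis
      using gradient_norm_bounds(3)[OF q4] by (simp add: n_def sgn_div_norm mult_pos_neg)
  qed
  let ?L = "cmod (complex_coordinate n X) / (2 * \<delta>)"
  have zn: "z = q - \<delta> *\<^sub>R n" using q(3) by (simp add: n_def)
  have "q - \<delta> *\<^sub>R n \<in> \<Omega>" using z(1) zn by simp
  from half_space_caratheodory_candidate[OF n half \<delta> this] have L: "?L \<in> C"
    unfolding C_def mem_Collect_eq zn by metis
  have prod: "q - c *s n + Y \<in> \<Omega>" if "c \<in> ball (of_real radius) radius" "Y \<in> complex_orthogonal n"
    "norm Y \<le> \<epsilon> / 20" for c Y
    using product_in_domain[OF q(1,2) that(1) _ that(3)] that(2) by (simp add: n_def)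
  have "0 < \<epsilon> / 20" using eps_pos by simp
  from product_kobayashi_candidate[OF n \<delta> \<delta>R this prod]
  obtain t \<phi> where t: "\<phi> \<in> holomorphic_from_disc \<Omega>" "\<phi> 0 = q - \<delta> *\<^sub>R n"
    "t *s (\<chi> i. deriv (\<lambda>\<zeta>. \<phi> \<zeta> $ i) 0) = X"
    "norm t \<le> ?L + (1 / radius + 3 / (\<epsilon> / 20)) * norm X" .
  have tK: "norm t \<in> K" unfolding K_def using t zn by blast
  have car: "caratheodory_metric \<Omega> z X = Sup C" by (simp add: caratheodory_metric_def C_def)
  have kob: "kobayashi_metric \<Omega> z X = Inf K" by (simp add: kobayashi_metric_def K_def)
  have "?L \<le> Sup C" using L CK[OF _ tK] by (intro cSup_upper bdd_aboveI) auto
  moreover have "Sup C \<le> norm t" using L CK[OF _ tK] by (intro cSup_least) auto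
  moreover have "?L \<le> Inf K" using tK CK[OF L] by (intro cInf_greatest) auto
  moreover have "Inf K \<le> norm t" using tK CK[OF L] by (intro cInf_lower bdd_belowI) auto
  ultimately have "?L \<le> \<alpha> z X" "\<alpha> z X \<le> ?L + (1 / radius + 60 / \<epsilon>) * norm X"
    using \<alpha> car kob t(4) by auto
  then show "0 \<le> \<alpha> z X - norm (normal_component \<Omega> \<rho> z X) / (2 * boundary_distance \<Omega> z)"
    "\<alpha> z X - norm (normal_component \<Omega> \<rho> z X) / (2 * boundary_distance \<Omega> z)
      \<le> (1 / radius + 60 / \<epsilon>) * norm X"
    unfolding XN \<delta>_def by auto
qed

end

theorem proposition9:
  fixes \<Omega> U :: "(complex^'n) set"
    and p :: "complex^'n"
    and \<rho> :: "complex^'n \<Rightarrow> real"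
    and \<alpha> :: "complex^'n \<Rightarrow> complex^'n \<Rightarrow> real"
  assumes "open \<Omega>" and "connected \<Omega>"
    and "C2_defining_function \<Omega> p U \<rho>"
    and "levi_flat_near \<Omega> p \<rho>"
    and "\<forall>\<^sub>F q in nhds p. q \<in> frontier \<Omega> \<longrightarrow> \<Omega> \<inter> real_tangent_hyperplane \<rho> q = {}"
    and "\<alpha> = caratheodory_metric \<Omega> \<or> \<alpha> = kobayashi_metric \<Omega>"
  shows "\<exists>V c. open V \<and> p \<in> V \<and> c > 0 \<and>
    (\<forall>z\<in>\<Omega> \<inter> V. (\<exists>!q. is_boundary_projection \<Omega> \<rho> z q) \<and>
      (\<forall>X. 0 \<le> \<alpha> z X - norm (normal_component \<Omega> \<rho> z X) / (2 * boundary_distance \<Omega> z) \<and>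
           \<alpha> z X - norm (normal_component \<Omega> \<rho> z X) / (2 * boundary_distance \<Omega> z) \<le> c * norm X))"
proof -
  have U: "open U" "p \<in> U" "C2_on U \<rho>" "p \<in> frontier \<Omega>"
    and nz: "\<And>x. x \<in> U \<Longrightarrow> frechet_derivative \<rho> (at x) \<noteq> (\<lambda>v. 0)"
    and dom: "\<Omega> \<inter> U = {x\<in>U. \<rho> x < 0}" and fro: "frontier \<Omega> \<inter> U = {x\<in>U. \<rho> x = 0}"
    using assms(3) unfolding C2_defining_function_def by auto
  obtain r M g H where r: "0 < r" "0 < M" "ball p r \<subseteq> U"
    and g: "\<And>x. x \<in> ball p r \<Longrightarrow> (\<rho> has_derivative (\<lambda>v. g x \<bullet> v)) (at x)"
    and H: "\<And>x. x \<in> ball p r \<Longrightarrow> (g has_derivative H x) (at x)"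
    and HM: "\<And>x v. x \<in> ball p r \<Longrightarrow> norm (H x v) \<le> M * norm v"
    and Hsym: "\<And>x v w. x \<in> ball p r \<Longrightarrow> H x v \<bullet> w = H x w \<bullet> v"
    using C2_on_gradient_hessian[OF U(1,3,2)] by metis
  have p: "p \<in> ball p r" using r by simp
  have gp: "g p \<noteq> 0" using nz[OF U(2)] frechet_derivative_at[OF g[OF p]] by auto
  have "isCont g p" using H[OF p] by (rule has_derivative_continuous)
  then have "\<forall>\<^sub>F x in nhds p. dist (g x) (g p) < norm (g p) / 4"
    using gp by (intro tendstoD) (auto simp: isCont_def tendsto_nhds_iff)
  moreover have "\<forall>\<^sub>F x in nhds p. x \<in> ball p r" using r by (intro eventually_nhds_in_open) auto
  ultimately have "\<forall>\<^sub>F x in nhds p. x \<in> ball p r \<and> dist (g x) (g p) < norm (g p) / 4 \<and>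
      (x \<in> frontier \<Omega> \<longrightarrow> \<Omega> \<inter> real_tangent_hyperplane \<rho> x = {}) \<and>
      (x \<in> frontier \<Omega> \<longrightarrow> (\<forall>X\<in>complex_tangent_space \<rho> x. \<forall>Y\<in>complex_tangent_space \<rho> x. complex_hessian \<rho> x X Y = 0))"
    using assms(4,5) unfolding levi_flat_near_def by eventually_elim auto
  then obtain e where e: "e > 0" and near: "\<And>x. dist x p < e \<Longrightarrow> x \<in> ball p r \<and> dist (g x) (g p) < norm (g p) / 4 \<and>
      (x \<in> frontier \<Omega> \<longrightarrow> \<Omega> \<inter> real_tangent_hyperplane \<rho> x = {}) \<and>
      (x \<in> frontier \<Omega> \<longrightarrow> (\<forall>X\<in>complex_tangent_space \<rho> x. \<forall>Y\<in>complex_tangent_space \<rho> x. complex_hessian \<rho> x X Y = 0))"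
    unfolding eventually_nhds_metric by blast
  define \<epsilon> where "\<epsilon> = e / 4"
  have e_eq: "4 * \<epsilon> = e" by (simp add: \<epsilon>_def)
  have tangent: "real_tangent_space \<rho> x = {v. g x \<bullet> v = 0}" if "x \<in> ball p r" for x
    using frechet_derivative_at[OF g[OF that]] by (auto simp: real_tangent_space_def fun_eq_iff)
  interpret supported_levi_flat_boundary \<Omega> p \<rho> g H \<epsilon> M
    unfolding supported_levi_flat_boundary_def e_eq
  proof (intro conjI allI impI)
    show "open \<Omega>" "connected \<Omega>" by (fact assms)+
    show "0 < \<epsilon>" "0 < M" "g p \<noteq> 0" using e r gp by (auto simp: \<epsilon>_def)
    show "\<rho> p = 0" using U fro by auto
    fix x assume "x \<in> ball p e"
    then have x: "x \<in> ball p r" "dist (g x) (g p) < norm (g p) / 4"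
      and x_supp: "x \<in> frontier \<Omega> \<Longrightarrow> \<Omega> \<inter> real_tangent_hyperplane \<rho> x = {}"
      and x_levi: "\<And>X. x \<in> frontier \<Omega> \<Longrightarrow> X \<in> complex_tangent_space \<rho> x \<Longrightarrow> complex_hessian \<rho> x X X = 0"
      using near[of x] by (auto simp: dist_commute)
    have xU: "x \<in> U" using x r by auto
    show "(\<rho> has_derivative (\<lambda>v. g x \<bullet> v)) (at x)" "(g has_derivative H x) (at x)"
      using g H x by auto
    show "norm (H x v) \<le> M * norm v" "H x v \<bullet> w = H x w \<bullet> v" for v w using HM Hsym x by auto
    show "norm (g x - g p) \<le> norm (g p) / 4" using x by (simp add: dist_norm)
    show "x \<in> \<Omega> \<longleftrightarrow> \<rho> x < 0" using dom xU by auto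
    show fx: "x \<in> frontier \<Omega> \<longleftrightarrow> \<rho> x = 0" using fro xU by auto
    assume "\<rho> x = 0"
    then have xf: "x \<in> frontier \<Omega>" using fx by simp
    show "x + w \<notin> \<Omega>" if "w \<bullet> g x = 0" for w
    proof -
      have "x + w \<in> real_tangent_hyperplane \<rho> x"
        using that tangent[OF x(1)] by (simp add: real_tangent_hyperplane_def inner_commute)
      then show ?thesis using x_supp[OF xf] by blast
    qed
    show "H x X \<bullet> X + H x (\<i> *s X) \<bullet> (\<i> *s X) = 0" if "X \<in> complex_orthogonal (g x)" for X
    proof -
      have "X \<in> complex_tangent_space \<rho> x"
        using that tangent[OF x(1)]
        by (simp add: complex_tangent_space_def complex_orthogonal_def inner_commute[of _ "g x"] inner_i_swap[of "g x"])
      then have "complex_hessian \<rho> x X X = 0" using x_levi[OF xf] by blast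
      moreover have "\<forall>\<^sub>F y in nhds x. y \<in> ball p r" using x by (intro eventually_nhds_in_open) auto
      then have "\<forall>\<^sub>F y in nhds x. (\<rho> has_derivative (\<lambda>v. g y \<bullet> v)) (at y)"
        by eventually_elim (rule g)
      ultimately show ?thesis using Re_complex_hessian[OF _ H[OF x(1)], of \<rho> X] by simp
    qed
  qed
  show ?thesis
  proof (intro exI conjI ballI)
    show "open (ball p (radius / 2))" "p \<in> ball p (radius / 2)" using radius_pos by auto
    show "1 / radius + 60 / \<epsilon> > 0" using radius_pos eps_pos by (intro add_pos_pos) auto
    fix z assume z: "z \<in> \<Omega> \<inter> ball p (radius / 2)"
    then have z': "z \<in> \<Omega>" "dist z p < radius / 2" by (auto simp: dist_commute)
    show "\<exists>!q. is_boundary_projection \<Omega> \<rho> z q" by (rule metric_estimate(1)[OF z' assms(6)])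
    show "\<forall>X. 0 \<le> \<alpha> z X - norm (normal_component \<Omega> \<rho> z X) / (2 * boundary_distance \<Omega> z) \<and>
        \<alpha> z X - norm (normal_component \<Omega> \<rho> z X) / (2 * boundary_distance \<Omega> z)
          \<le> (1 / radius + 60 / \<epsilon>) * norm X"
      using metric_estimate(2,3)[OF z' assms(6)] by blast
  qed
qed

end
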